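(* Let $r\ge 2$ be an integer and let $p\ne 2^r-1$ be an odd prime. Let $O_2(p)$ denote the multiplicative order of $2$ modulo $p$. If $rO_2(p)$ is even or $r\nmid(p-1)$, then $p^n$ is a complete number of the spectral pair $(\mu_{2^r,\{0,2^{r-1}\}},\Lambda(2^r,\{0,1\}))$ for each integer $n\ge 1$.
   Context: $\mu_{2^r,\{0,2^{r-1}\}}$ is the unique Borel probability measure $\mu$ on $\mathbb R$ satisfying $\mu(\cdot)=\frac12\mu\circ\phi_0^{-1}(\cdot)+\frac12\mu\circ\phi_1^{-1}(\cdot)$, where $\phi_0(x)=2^{-r}x$ and $\phi_1(x)=2^{-r}(x+2^{r-1})$. $\Lambda(2^r,\{0,1\})=\{\sum_{k=0}^n 2^{rk}c_k: n\ge0,\ c_k\in\{0,1\}\}$. A pair $(\mu,\Lambda)$ of a compactly supported Borel probability measure on $\mathbb R$ and a countable set $\Lambda\subset\mathbb R$ is a spectral pair if $\{e^{-2\pi i\lambda x}:\lambda\in\Lambda\}$ is an orthonormal basis of $L^2(\mu)$. It is known that $(\mu_{2^r,\{0,2^{r-1}\}},\Lambda(2^r,\{0,1\}))$ is a spectral pair. A real number $t$ is a complete number of a spectral pair $(\mu,\Lambda)$ if $(\mu,t\Lambda)$ is also a spectral pair. *)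

theory Defs
  imports "HOL-Probability.Probability" "HOL-Number_Theory.Number_Theory"
begin

definition phi0 :: "nat \<Rightarrow> real \<Rightarrow> real" where
  "phi0 r x = x / 2 ^ r"

definition phi1 :: "nat \<Rightarrow> real \<Rightarrow> real" where
  "phi1 r x = (x + 2 ^ (r - 1)) / 2 ^ r"

definition invariant_measure :: "nat \<Rightarrow> real measure \<Rightarrow> bool" where
  "invariant_measure r \<mu> \<longleftrightarrow>
     prob_space \<mu> \<and> sets \<mu> = sets borel \<and>
     (\<forall>A \<in> sets borel.
        measure \<mu> A = 1/2 * measure \<mu> (phi0 r -` A) + 1/2 * measure \<mu> (phi1 r -` A))"

text \<open>
  The measure \<open>\<mu>\<close> with scaling \<open>2\<^sup>r\<close> and digits \<open>{0, 2\<^sup>r\<^sup>-\<^sup>1}\<close>. The definite description is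
  justified by \<open>ex1_invariant_measure\<close> below for \<open>r \<ge> 1\<close>.
\<close>
definition cantor_measure :: "nat \<Rightarrow> real measure" where
  "cantor_measure r = (THE \<mu>. invariant_measure r \<mu>)"

definition Lambda :: "nat \<Rightarrow> real set" where
  "Lambda r = {\<Sum>k\<le>n. 2 ^ (r * k) * c k | (n :: nat) (c :: nat \<Rightarrow> real). \<forall>k\<le>n. c k \<in> {0, 1}}"

definition expo :: "real \<Rightarrow> real \<Rightarrow> complex" where
  "expo l x = exp (- 2 * of_real pi * \<i> * of_real l * of_real x)"

definition compactly_supported :: "real measure \<Rightarrow> bool" where
  "compactly_supported \<mu> \<longleftrightarrow> (\<exists>K. compact K \<and> emeasure \<mu> (- K) = 0)"

definition square_integrable :: "real measure \<Rightarrow> (real \<Rightarrow> complex) \<Rightarrow> bool" where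
  "square_integrable \<mu> f \<longleftrightarrow>
     f \<in> borel_measurable \<mu> \<and> integrable \<mu> (\<lambda>x. (cmod (f x))\<^sup>2)"

text \<open>
  Elements of \<open>L\<^sup>2(\<mu>)\<close> are represented by square-integrable functions. The exponentials are
  indexed by their frequency, so distinct frequencies must give orthogonal functions. An
  orthonormal basis is an orthonormal family whose finite linear combinations are dense.
\<close>
definition orthonormal_exponentials :: "real measure \<Rightarrow> real set \<Rightarrow> bool" where
  "orthonormal_exponentials \<mu> \<Lambda> \<longleftrightarrow>
     (\<forall>l\<in>\<Lambda>. \<forall>l'\<in>\<Lambda>. (\<integral>x. expo l x * cnj (expo l' x) \<partial>\<mu>) = (if l = l' then 1 else 0))"

definition total_exponentials :: "real measure \<Rightarrow> real set \<Rightarrow> bool" where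
  "total_exponentials \<mu> \<Lambda> \<longleftrightarrow>
     (\<forall>f. square_integrable \<mu> f \<longrightarrow>
        (\<forall>\<epsilon>>0. \<exists>(F :: real set) (c :: real \<Rightarrow> complex). finite F \<and> F \<subseteq> \<Lambda> \<and>
           (\<integral>x. (cmod (f x - (\<Sum>l\<in>F. c l * expo l x)))\<^sup>2 \<partial>\<mu>) < \<epsilon>))"

definition spectral_pair :: "real measure \<Rightarrow> real set \<Rightarrow> bool" where
  "spectral_pair \<mu> \<Lambda> \<longleftrightarrow>
     prob_space \<mu> \<and> sets \<mu> = sets borel \<and> compactly_supported \<mu> \<and> countable \<Lambda> \<and>
     orthonormal_exponentials \<mu> \<Lambda> \<and> total_exponentials \<mu> \<Lambda>"

definition complete_number :: "real measure \<Rightarrow> real set \<Rightarrow> real \<Rightarrow> bool" where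
  "complete_number \<mu> \<Lambda> t \<longleftrightarrow> spectral_pair \<mu> \<Lambda> \<and> spectral_pair \<mu> ((*) t ` \<Lambda>)"


text \<open>Existence and uniqueness of the invariant measure\<close>

lemma measurable_phi [measurable]:
  "phi0 r \<in> borel_measurable borel" "phi1 r \<in> borel_measurable borel"
  unfolding phi0_def [abs_def] phi1_def [abs_def] by measurable

lemma real_distribution_invariant:
  assumes "invariant_measure r \<mu>"
  shows "real_distribution \<mu>"
  using assms unfolding invariant_measure_def real_distribution_def real_distribution_axioms_def
  by simp

lemma invariant_nn_integral:
  assumes inv: "invariant_measure r \<mu>" and [measurable]: "f \<in> borel_measurable borel"
  shows "(\<integral>\<^sup>+x. f x \<partial>\<mu>) =
    ennreal (1/2) * (\<integral>\<^sup>+x. f (phi0 r x) \<partial>\<mu>) + ennreal (1/2) * (\<integral>\<^sup>+x. f (phi1 r x) \<partial>\<mu>)"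
proof -
  interpret real_distribution \<mu> by (rule real_distribution_invariant [OF inv])
  have em: "emeasure \<mu> A = ennreal (1/2) * emeasure \<mu> (phi0 r -` A) + ennreal (1/2) * emeasure \<mu> (phi1 r -` A)"
    if "A \<in> sets borel" for A
    using inv that unfolding invariant_measure_def emeasure_eq_measure
    by (simp only: ennreal_mult' [symmetric] ennreal_plus [symmetric] measure_nonneg
        mult_nonneg_nonneg zero_le_divide_1_iff zero_le_numeral)
  have m: "f \<in> borel_measurable \<mu>" by simp
  show ?thesis
    using assms(2)
  proof (induction rule: borel_measurable_induct)
    case (cong f g)
    then have "f = g" by (simp add: fun_eq_iff)
    with cong show ?case by simp
  next
    case (set A)
    have [measurable]: "A \<in> sets borel" by fact
    have v: "phi0 r -` A \<in> sets borel" "phi1 r -` A \<in> sets borel"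
      using measurable_sets [OF measurable_phi(1) set, of r]
        measurable_sets [OF measurable_phi(2) set, of r] by auto
    have "(\<integral>\<^sup>+x. indicator A (phi0 r x) \<partial>\<mu>) = emeasure \<mu> (phi0 r -` A)"
      "(\<integral>\<^sup>+x. indicator A (phi1 r x) \<partial>\<mu>) = emeasure \<mu> (phi1 r -` A)"
      using v by (simp_all flip: nn_integral_indicator add: indicator_vimage)
    then show ?case using em [OF set] set by simp
  next
    case (mult u c)
    have [measurable]: "u \<in> borel_measurable borel" by fact
    show ?case
      using mult by (simp add: nn_integral_cmult distrib_left mult.left_commute)
  next
    case (add u v)
    have [measurable]: "u \<in> borel_measurable borel" "v \<in> borel_measurable borel" by fact+
    show ?case
      using add by (simp add: nn_integral_add distrib_left add_ac)
  next
    case (seq U)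
    have [measurable]: "U i \<in> borel_measurable borel" for i by fact
    have s: "(SUP i. U i) x = (SUP i. U i x)" for x by (simp add: image_comp)
    have inc: "incseq (\<lambda>i x. U i (g x))" for g :: "real \<Rightarrow> real"
      using \<open>incseq U\<close> by (auto simp: incseq_def le_fun_def)
    have i2: "incseq (\<lambda>i. ennreal (1/2) * (\<integral>\<^sup>+x. U i (g x) \<partial>\<mu>))" for g :: "real \<Rightarrow> real"
      using inc [of g] by (auto simp: incseq_def le_fun_def intro!: mult_left_mono nn_integral_mono)
    show ?case
      unfolding s
      using seq inc [of "\<lambda>x. x"] inc [of "phi0 r"] inc [of "phi1 r"] i2 [of "phi0 r"] i2 [of "phi1 r"]
      by (simp add: nn_integral_monotone_convergence_SUP SUP_mult_left_ennreal ennreal_SUP_add)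
  qed
qed

lemma invariant_integral:
  fixes f :: "real \<Rightarrow> real"
  assumes inv: "invariant_measure r \<mu>" 
    and f [measurable]: "f \<in> borel_measurable borel" and b: "\<And>x. norm (f x) \<le> B"
  shows "(\<integral>x. f x \<partial>\<mu>) = (\<integral>x. (f (phi0 r x) + f (phi1 r x)) / 2 \<partial>\<mu>)"
proof -
  interpret real_distribution \<mu> by (rule real_distribution_invariant [OF inv])
  have int: "integrable \<mu> (\<lambda>x. f (g x))" if [measurable]: "g \<in> borel_measurable borel" for g
    by (rule integrable_const_bound [of _ B]) (use b in auto)
  have B: "f x + B \<ge> 0" for x using b [of x] by auto
  have "ennreal (\<integral>x. f x + B \<partial>\<mu>) = (\<integral>\<^sup>+x. f x + B \<partial>\<mu>)"
    using int [of "\<lambda>x. x"] B by (intro nn_integral_eq_integral [symmetric]) auto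
  also have "\<dots> = ennreal (1/2) * (\<integral>\<^sup>+x. f (phi0 r x) + B \<partial>\<mu>) + ennreal (1/2) * (\<integral>\<^sup>+x. f (phi1 r x) + B \<partial>\<mu>)"
    by (rule invariant_nn_integral [OF inv]) measurable
  also have "\<dots> = ennreal (1/2) * ennreal (\<integral>x. f (phi0 r x) + B \<partial>\<mu>) + ennreal (1/2) * ennreal (\<integral>x. f (phi1 r x) + B \<partial>\<mu>)"
    using int [of "phi0 r"] int [of "phi1 r"] B by (subst (1 2) nn_integral_eq_integral) auto
  also have "\<dots> = ennreal (1/2 * (\<integral>x. f (phi0 r x) + B \<partial>\<mu>) + 1/2 * (\<integral>x. f (phi1 r x) + B \<partial>\<mu>))"
    using B by (simp only: ennreal_mult' [symmetric] ennreal_plus [symmetric] integral_nonneg_AE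
        AE_I2 mult_nonneg_nonneg zero_le_divide_1_iff zero_le_numeral)
  finally have "(\<integral>x. f x + B \<partial>\<mu>) = 1/2 * (\<integral>x. f (phi0 r x) + B \<partial>\<mu>) + 1/2 * (\<integral>x. f (phi1 r x) + B \<partial>\<mu>)"
    using B by (subst (asm) ennreal_inj) (auto intro!: integral_nonneg_AE add_nonneg_nonneg)
  then show ?thesis
    using int [of "\<lambda>x. x"] int [of "phi0 r"] int [of "phi1 r"]
    by (simp add: prob_space [unfolded space_eq_univ] add_divide_distrib)
qed

lemma char_invariant:
  assumes inv: "invariant_measure r \<mu>"
  shows "char \<mu> t = (1 + iexp (t * 2 ^ (r - 1) / 2 ^ r)) / 2 * char \<mu> (t / 2 ^ r)"
proof -
  interpret real_distribution \<mu> by (rule real_distribution_invariant [OF inv])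
  have int: "integrable \<mu> (\<lambda>x. iexp (t * g x))" if [measurable]: "g \<in> borel_measurable borel" for g
    by (rule integrable_const_bound [of _ 1]) auto
  have intG: "integrable \<mu> (\<lambda>x. (iexp (t * phi0 r x) + iexp (t * phi1 r x)) / 2)"
    using int [of "phi0 r"] int [of "phi1 r"] by auto
  have "(\<integral>x. iexp (t * x) \<partial>\<mu>) = (\<integral>x. (iexp (t * phi0 r x) + iexp (t * phi1 r x)) / 2 \<partial>\<mu>)"
  proof (rule complex_eqI)
    have "Re (\<integral>x. iexp (t * x) \<partial>\<mu>) = (\<integral>x. Re (iexp (t * x)) \<partial>\<mu>)"
      using int [of "\<lambda>x. x"] by simp
    also have "\<dots> = (\<integral>x. (Re (iexp (t * phi0 r x)) + Re (iexp (t * phi1 r x))) / 2 \<partial>\<mu>)"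
      by (rule invariant_integral [OF inv, of _ 1])
        (measurable, metis abs_Re_le_cmod norm_exp_i_times real_norm_def)
    also have "\<dots> = Re (\<integral>x. (iexp (t * phi0 r x) + iexp (t * phi1 r x)) / 2 \<partial>\<mu>)"
      by (subst integral_Re [OF intG, symmetric]) simp
    finally show "Re (\<integral>x. iexp (t * x) \<partial>\<mu>) = Re (\<integral>x. (iexp (t * phi0 r x) + iexp (t * phi1 r x)) / 2 \<partial>\<mu>)" .
  next
    have "Im (\<integral>x. iexp (t * x) \<partial>\<mu>) = (\<integral>x. Im (iexp (t * x)) \<partial>\<mu>)"
      using int [of "\<lambda>x. x"] by simp
    also have "\<dots> = (\<integral>x. (Im (iexp (t * phi0 r x)) + Im (iexp (t * phi1 r x))) / 2 \<partial>\<mu>)"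
      by (rule invariant_integral [OF inv, of _ 1])
        (measurable, metis abs_Im_le_cmod norm_exp_i_times real_norm_def)
    also have "\<dots> = Im (\<integral>x. (iexp (t * phi0 r x) + iexp (t * phi1 r x)) / 2 \<partial>\<mu>)"
      by (subst integral_Im [OF intG, symmetric]) simp
    finally show "Im (\<integral>x. iexp (t * x) \<partial>\<mu>) = Im (\<integral>x. (iexp (t * phi0 r x) + iexp (t * phi1 r x)) / 2 \<partial>\<mu>)" .
  qed
  also have "\<dots> = (\<integral>x. (1 + iexp (t * 2 ^ (r - 1) / 2 ^ r)) / 2 * iexp (t / 2 ^ r * x) \<partial>\<mu>)"
  proof (rule Bochner_Integration.integral_cong)
    fix x
    have 0: "iexp (t * phi0 r x) = iexp (t / 2 ^ r * x)"
      by (simp add: phi0_def)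
    have 1: "iexp (t * phi1 r x) = iexp (t * 2 ^ (r - 1) / 2 ^ r) * iexp (t / 2 ^ r * x)"
      unfolding exp_add [symmetric] distrib_left [symmetric] of_real_add [symmetric]
      by (simp add: phi1_def add_divide_distrib distrib_left add.commute)
    show "(iexp (t * phi0 r x) + iexp (t * phi1 r x)) / 2 =
      (1 + iexp (t * 2 ^ (r - 1) / 2 ^ r)) / 2 * iexp (t / 2 ^ r * x)"
      unfolding 0 1 by (simp add: field_simps)
  qed simp
  finally show ?thesis
    unfolding char_def by (simp only: integral_mult_right_zero)
qed

lemma invariant_measure_unique:
  assumes r: "r \<ge> 1" and "invariant_measure r \<mu>" "invariant_measure r \<nu>"
  shows "\<mu> = \<nu>"
proof (rule Levy_uniqueness)
  interpret M: real_distribution \<mu> by (rule real_distribution_invariant [OF assms(2)])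
  interpret N: real_distribution \<nu> by (rule real_distribution_invariant [OF assms(3)])
  show "real_distribution \<mu>" "real_distribution \<nu>" by unfold_locales
  show "char \<mu> = char \<nu>"
  proof
    fix t
    define d where "d s = cmod (char \<mu> s - char \<nu> s)" for s
    have step: "d s \<le> d (s / 2 ^ r)" for s
    proof -
      have "d s = cmod ((1 + iexp (s * 2 ^ (r - 1) / 2 ^ r)) / 2) * d (s / 2 ^ r)"
        unfolding d_def norm_mult [symmetric] right_diff_distrib
        by (subst char_invariant [OF assms(2)], subst char_invariant [OF assms(3)]) (rule refl)
      moreover have "cmod ((1 + iexp (s * 2 ^ (r - 1) / 2 ^ r)) / 2) \<le> 1"
        using norm_triangle_ineq [of 1 "iexp (s * 2 ^ (r - 1) / 2 ^ r)"]
        by (simp add: norm_divide del: of_real_divide of_real_mult)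
      ultimately show ?thesis
        using mult_right_mono [of _ 1 "d (s / 2 ^ r)"] by (metis d_def mult_1 norm_ge_zero)
    qed
    have le: "d t \<le> d (t * (1 / 2 ^ r) ^ k)" for k
    proof (induction k)
      case (Suc k)
      then show ?case using step [of "t * (1 / 2 ^ r) ^ k"] by (simp add: field_simps)
    qed simp
    have "(\<lambda>k. t * (1 / 2 ^ r) ^ k) \<longlonglongrightarrow> t * 0"
      using r by (intro tendsto_mult tendsto_const LIMSEQ_power_zero) simp
    moreover have "isCont d 0"
      unfolding d_def [abs_def] by (intro continuous_intros M.isCont_char N.isCont_char)
    ultimately have "(\<lambda>k. d (t * (1 / 2 ^ r) ^ k)) \<longlonglongrightarrow> d 0"
      using isCont_tendsto_compose [of 0 d] by simp
    then have "d t \<le> d 0"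
      by (rule LIMSEQ_le_const) (use le in auto)
    then show "char \<mu> t = char \<nu> t"
      by (simp add: d_def M.char_zero N.char_zero)
  qed
qed

lemma invariant_measure_exists:
  assumes r: "r \<ge> 1"
  shows "\<exists>\<mu>. invariant_measure r \<mu>"
proof -
  define P where "P = measure_pmf (bernoulli_pmf (1/2))"
  define X :: "bool stream \<Rightarrow> real" where
    "X s = (\<Sum>k. of_bool (s !! k) * 2 ^ (r - 1) * (1 / 2 ^ r) ^ Suc k)"
    for s :: "bool stream"
  interpret P: prob_space P unfolding P_def by (rule measure_pmf.prob_space_axioms)
  have sP [measurable_cong]: "sets P = sets (count_space UNIV)" by (simp add: P_def)
  interpret S: prob_space "stream_space P" by (rule P.prob_space_stream_space)
  have spS: "space (stream_space P) = UNIV"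
    by (simp add: space_stream_space P_def)
  have summ: "summable (\<lambda>k. of_bool (s !! k) * 2 ^ (r - 1) * (1 / 2 ^ r) ^ Suc k :: real)" for s
  proof (rule summable_comparison_test')
    show "summable (\<lambda>k. 2 ^ (r - 1) * (1 / 2 ^ r) ^ Suc k :: real)"
      unfolding power_Suc using r by (intro summable_mult summable_geometric) simp
  qed simp
  have X_Cons: "X (b ## s) = (if b then phi1 r (X s) else phi0 r (X s))" for b s
  proof -
    have "X (b ## s) = (\<Sum>k. of_bool (s !! k) * 2 ^ (r - 1) * (1 / 2 ^ r) ^ Suc (Suc k))
        + of_bool b * 2 ^ (r - 1) * (1 / 2 ^ r)"
      unfolding X_def using suminf_split_head [OF summ [of "b ## s"]] by simp
    also have "(\<Sum>k. of_bool (s !! k) * 2 ^ (r - 1) * (1 / 2 ^ r) ^ Suc (Suc k)) = X s / 2 ^ r"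
      unfolding X_def by (subst suminf_divide [OF summ, symmetric]) (simp add: field_simps)
    finally show ?thesis by (simp add: phi0_def phi1_def add_divide_distrib)
  qed
  have [measurable]: "X \<in> borel_measurable (stream_space P)"
    unfolding X_def by measurable
  define \<mu> where "\<mu> = distr (stream_space P) borel X"
  have "invariant_measure r \<mu>"
    unfolding invariant_measure_def
  proof (intro conjI ballI)
    show "prob_space \<mu>" unfolding \<mu>_def by (rule S.prob_space_distr) measurable
    show "sets \<mu> = sets borel" by (simp add: \<mu>_def)
    fix A :: "real set" assume A [measurable]: "A \<in> sets borel"
    have v: "phi0 r -` A \<in> sets borel" "phi1 r -` A \<in> sets borel"
      using measurable_sets [OF measurable_phi(1) A, of r]
        measurable_sets [OF measurable_phi(2) A, of r] by auto
    have m: "measure \<mu> B = measure (stream_space P) {s. X s \<in> B}" if "B \<in> sets borel" for B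
      unfolding \<mu>_def using that by (subst measure_distr) (auto simp: spS vimage_def)
    have "ennreal (measure (stream_space P) {s. X s \<in> A}) =
        (\<integral>\<^sup>+b. ennreal (measure (stream_space P) {s. X (b ## s) \<in> A}) \<partial>P)"
      using P.prob_stream_space [of "\<lambda>s. X s \<in> A"]
        measurable_sets [OF \<open>X \<in> borel_measurable (stream_space P)\<close> A]
      by (simp add: spS vimage_def)
    also have "\<dots> = ennreal (1/2) * ennreal (measure \<mu> (phi1 r -` A)) +
        ennreal (1/2) * ennreal (measure \<mu> (phi0 r -` A))"
      unfolding m [OF v(1)] m [OF v(2)] P_def
      by (simp add: X_Cons mult.commute)
    also have "\<dots> = ennreal (1/2 * measure \<mu> (phi0 r -` A) + 1/2 * measure \<mu> (phi1 r -` A))"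
      by (simp only: ennreal_mult' [symmetric] ennreal_plus [symmetric] measure_nonneg
        mult_nonneg_nonneg zero_le_divide_1_iff zero_le_numeral add.commute)
    finally show "measure \<mu> A = 1/2 * measure \<mu> (phi0 r -` A) + 1/2 * measure \<mu> (phi1 r -` A)"
      unfolding m [OF A] by (subst (asm) ennreal_inj) auto
  qed
  then show ?thesis ..
qed

theorem ex1_invariant_measure:
  assumes "r \<ge> 1"
  shows "\<exists>!\<mu>. invariant_measure r \<mu>"
  using invariant_measure_exists [OF assms] invariant_measure_unique [OF assms] by blast

corollary invariant_cantor_measure:
  assumes "r \<ge> 1"
  shows "invariant_measure r (cantor_measure r)"
  unfolding cantor_measure_def by (rule theI' [OF ex1_invariant_measure [OF assms]])

end

theory Submission
  imports Defs
begin

text \<open>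
  Write \<open>q = 2\<^sup>r\<close> and let \<open>t\<close> be odd and positive. The Fourier transform \<open>ft\<close> of the measure satisfies
  \<open>|ft x|\<^sup>2 = cos\<^sup>2(\<pi> x / 2) |ft (x / q)|\<^sup>2\<close>, so it vanishes at \<open>q\<^sup>k j\<close> with \<open>j\<close> odd, which gives the
  orthogonality of the exponentials with frequencies in \<open>t \<Lambda>\<close>. Completeness amounts to
  \<open>Q x = (\<Sum>l\<in>\<Lambda>. |ft (x + t l)|\<^sup>2) = 1\<close> for all \<open>x\<close>; a minimum of \<open>Q\<close> below \<open>1\<close> forces a nonzero cycle
  of integers \<open>z\<close> with \<open>q z' \<in> {z, z + t}\<close>. Modulo \<open>t = p\<^sup>n\<close>, and after division by a power of \<open>p\<close>,
  such a cycle is closed under multiplication by \<open>q\<close> modulo some \<open>p\<^sup>s\<close> and lies in \<open>(0, p\<^sup>s / (q - 1)]\<close>.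
  Unless \<open>r\<close> divides the order of \<open>2\<close> modulo \<open>p\<^sup>s\<close>, the group generated by \<open>q\<close> contains a smaller power
  of \<open>2\<close>, and if that order is even it contains \<open>-1\<close> or \<open>-2^(r/2)\<close>; all of these move small residues to
  large ones. If \<open>r\<close> divides the odd order, then the hypothesis forces \<open>p\<close> to divide \<open>r\<close>, and then
  \<open>q\<close> is too large compared with \<open>p\<close>.
\<close>

section \<open>Powers of two modulo prime powers\<close>

text \<open>Representatives are taken in \<open>{1..m}\<close>, with \<open>m\<close> included,
  because the bound on an orbit modulo \<open>p ^ (s - 1)\<close> in \<open>not_small_orbit\<close>
  is not strict. Subtracting one brings them below the modulus.\<close>

lemma cong_bounded_imp_eq:
  fixes x y m :: nat
  assumes "[x = y] (mod m)" "0 < x" "x \<le> m" "0 < y" "y \<le> m"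
  shows "x = y"
proof -
  have "[x - 1 = y - 1] (mod m)"
    using cong_diff_nat [OF assms(1) cong_refl, of 1] assms by simp
  then have "x - 1 = y - 1"
    using assms by (intro cong_less_modulus_unique_nat) auto
  then show ?thesis using assms by simp
qed

text \<open>The geometric sum \<open>1 + a + \<dots> + a\<^sup>p\<^sup>-\<^sup>1\<close> is \<open>p\<close> modulo \<open>p\<^sup>2\<close>, because \<open>p\<close> divides \<open>p (p - 1) / 2\<close>.\<close>
lemma cong_pow_prime_descent:
  fixes p s a :: nat
  assumes p: "prime p" "odd p" and a: "[a ^ p = 1] (mod p ^ s)"
  shows "[a = 1] (mod p ^ (s - 1))"
proof (cases "s \<ge> 1")
  case False
  then show ?thesis by simp
next
  case True
  \<comment> \<open>Fermat gives \<open>a ^ p = a\<close> modulo \<open>p\<close>, while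
    \<open>a ^ p = 1\<close> there by assumption.\<close>
  have ap: "[a = 1] (mod p)"
  proof -
    have "[a ^ p = 1] (mod p)"
      using a True cong_dvd_modulus_nat [of "a ^ p" 1 "p ^ s" p] by (simp add: dvd_power)
    moreover have np: "\<not> p dvd a"
    proof
      assume "p dvd a"
      then have "p dvd a ^ p" using p by (simp add: prime_gt_0_nat dvd_power_iff dvd_trans)
      then have "p dvd 1" using \<open>[a ^ p = 1] (mod p)\<close> cong_dvd_iff by blast
      then show False using p by auto
    qed
    moreover have "[a ^ p = a] (mod p)"
    proof -
      have "a ^ p = a ^ (p - 1) * a" using p by (metis Suc_diff_1 power_Suc2 prime_gt_0_nat)
      moreover have "[a ^ (p - 1) * a = 1 * a] (mod p)"
        by (rule cong_mult [OF fermat_theorem cong_refl]) (use p np in auto)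
      ultimately show ?thesis by simp
    qed
    ultimately show ?thesis using cong_sym cong_trans by blast
  qed
  define b where "b = int a"
  obtain c where c: "b = 1 + int p * c"
  proof -
    have "[b = 1] (mod int p)" using ap by (metis b_def cong_int_iff of_nat_1)
    then have "int p dvd b - 1" by (simp add: cong_iff_dvd_diff)
    then show thesis using that by (metis add.commute diff_add_cancel dvdE)
  qed
  define S where "S = (\<Sum>i<p. b ^ i)"
  have lin: "[b ^ i = 1 + int i * (int p * c)] (mod (int p)\<^sup>2)" for i
  proof (induction i)
    case (Suc i)
    have "[b ^ Suc i = (1 + int p * c) * (1 + int i * (int p * c))] (mod (int p)\<^sup>2)"
      unfolding power_Suc using Suc c by (intro cong_mult) auto
    also have "(1 + int p * c) * (1 + int i * (int p * c))
        = 1 + int (Suc i) * (int p * c) + (int p)\<^sup>2 * (int i * c\<^sup>2)"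
      by (simp add: algebra_simps power2_eq_square)
    also have "[\<dots> = 1 + int (Suc i) * (int p * c)] (mod (int p)\<^sup>2)"
      by (simp add: cong_iff_dvd_diff)
    finally show ?case .
  qed simp
  have "[S = (\<Sum>i<p. 1 + int i * (int p * c))] (mod (int p)\<^sup>2)"
    unfolding S_def by (intro cong_sum lin)
  also have "(\<Sum>i<p. 1 + int i * (int p * c)) = int p + (\<Sum>i<p. int i) * (int p * c)"
    by (simp add: sum.distrib sum_distrib_right)
  also have "(\<Sum>i<p. int i) = int p * (int (p div 2))"
  proof -
    obtain k where k: "p = 2 * k + 1" using p by (elim oddE)
    have "(\<Sum>i<2 * k + 1. int i) = int (2 * k + 1) * int k" by (induction k) (auto simp: algebra_simps)
    then show ?thesis using k by simp
  qed
  also have "[int p + int p * int (p div 2) * (int p * c) = int p] (mod (int p)\<^sup>2)"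
    by (simp add: cong_iff_dvd_diff power2_eq_square)
  finally have S: "[S = int p] (mod (int p)\<^sup>2)" .
  have "int p dvd S"
    using S by (meson cong_dvd_iff cong_dvd_modulus dvd_refl dvd_power pos2)
  then obtain S' where S': "S = int p * S'" by (elim dvdE)
  \<comment> \<open>\<open>S\<close> contains the factor \<open>p\<close> exactly once, so all but
    one of the factors of \<open>p ^ s\<close> must divide \<open>b - 1\<close>.\<close>
  have "\<not> int p dvd S'"
  proof
    assume "int p dvd S'"
    then have "(int p)\<^sup>2 dvd S" by (simp add: S' power2_eq_square)
    then have "(int p)\<^sup>2 dvd int p" using S by (meson cong_dvd_iff dvd_refl)
    then have "p ^ 2 dvd p" by (metis int_dvd_int_iff of_nat_power)
    then show False using p by (metis dvd_mult_cancel2 power2_eq_square nat_dvd_1_iff_1 not_prime_1 prime_gt_0_nat)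
  qed
  then have cop: "coprime (int p ^ (s - 1)) S'"
    using p by (simp add: prime_imp_coprime)
  have "int p ^ s dvd b ^ p - 1"
    using a unfolding b_def by (metis cong_iff_dvd_diff cong_int_iff of_nat_1 of_nat_power)
  also have "b ^ p - 1 = (b - 1) * S"
    unfolding S_def by (rule power_diff_1_eq)
  finally have "int p * int p ^ (s - 1) dvd int p * (S' * (b - 1))"
    using True by (simp add: S' ac_simps flip: power_Suc)
  then have "int p ^ (s - 1) dvd S' * (b - 1)" using p by (simp add: prime_gt_0_nat)
  then have "int p ^ (s - 1) dvd b - 1" using cop by (simp add: coprime_dvd_mult_right_iff)
  then show ?thesis
    unfolding b_def by (metis cong_iff_dvd_diff cong_int_iff of_nat_1 of_nat_power)
qed

lemma cong_pow_prime_power_descent: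
  fixes p s a e :: nat
  assumes "prime p" "odd p" "[a ^ (p ^ e) = 1] (mod p ^ s)"
  shows "[a = 1] (mod p ^ (s - e))"
  using assms(3)
proof (induction e arbitrary: s)
  case (Suc e)
  have "[(a ^ (p ^ e)) ^ p = 1] (mod p ^ s)"
    using Suc.prems by (simp add: power_mult [symmetric] mult.commute)
  then have "[a ^ (p ^ e) = 1] (mod p ^ (s - 1))"
    by (rule cong_pow_prime_descent [OF assms(1,2)])
  then show ?case using Suc.IH by fastforce
qed simp

text \<open>The factors \<open>y - 1\<close> and \<open>y + 1\<close> differ by 2, so the odd prime
  \<open>p\<close> divides at most one of them and its whole power goes into a single
  factor.\<close>

lemma square_cong_1_prime_power:
  fixes p s :: nat and y :: int
  assumes p: "prime p" "odd p" and y: "[y\<^sup>2 = 1] (mod int p ^ s)"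
  shows "[y = 1] (mod int p ^ s) \<or> [y = -1] (mod int p ^ s)"
proof -
  have d: "int p ^ s dvd (y - 1) * (y + 1)"
    using y by (simp add: cong_iff_dvd_diff algebra_simps power2_eq_square)
  have pp: "prime (int p)" using p by simp
  show ?thesis
  proof (cases "int p dvd y - 1")
    case True
    have "\<not> int p dvd y + 1"
    proof
      assume "int p dvd y + 1"
      then have "int p dvd (y + 1) - (y - 1)" using True by (rule dvd_diff)
      then have "p dvd 2" by (simp flip: int_dvd_int_iff)
      then show False using p by (metis even_numeral primes_dvd_imp_eq two_is_prime_nat)
    qed
    then have "coprime (int p ^ s) (y + 1)" using pp by (simp add: prime_imp_coprime)
    then show ?thesis using d by (simp add: coprime_dvd_mult_left_iff cong_iff_dvd_diff)
  next
    case False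
    then have "coprime (int p ^ s) (y - 1)" using pp by (simp add: prime_imp_coprime)
    then show ?thesis using d by (simp add: coprime_dvd_mult_right_iff cong_iff_dvd_diff)
  qed
qed

text \<open>The half power squares to 1, so it is 1 or -1; minimality of the order excludes
  1.\<close>

lemma pow_2_half_ord:
  fixes p s :: nat
  assumes p: "prime p" "odd p" and ev: "even (ord (p ^ s) 2)"
  shows "[2 ^ (ord (p ^ s) 2 div 2) = (-1 :: int)] (mod int p ^ s)"
proof -
  define d where "d = ord (p ^ s) (2::nat)"
  have "coprime (p ^ s) (2::nat)" using p by simp
  then have d: "0 < d" unfolding d_def ord_gt_0_iff .
  have "[(2 :: nat) ^ d = 1] (mod p ^ s)" unfolding d_def by (rule ord)
  then have "[2 ^ d = (1 :: int)] (mod int p ^ s)"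
    by (metis cong_int_iff of_nat_1 of_nat_numeral of_nat_power)
  then have "[(2 ^ (d div 2))\<^sup>2 = (1 :: int)] (mod int p ^ s)"
    using ev by (simp add: d_def flip: power_mult)
  then have "[2 ^ (d div 2) = (1 :: int)] (mod int p ^ s) \<or> [2 ^ (d div 2) = (-1 :: int)] (mod int p ^ s)"
    by (rule square_cong_1_prime_power [OF p])
  moreover have "\<not> [2 ^ (d div 2) = (1 :: int)] (mod int p ^ s)"
  proof
    assume "[2 ^ (d div 2) = (1 :: int)] (mod int p ^ s)"
    then have "[(2 :: nat) ^ (d div 2) = 1] (mod p ^ s)"
      by (metis cong_int_iff of_nat_1 of_nat_numeral of_nat_power)
    then have "d dvd d div 2" unfolding d_def ord_divides .
    moreover have "0 < d div 2" "d div 2 < d" using d ev unfolding d_def [symmetric] by (auto elim: evenE)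
    ultimately show False by (meson dvd_imp_le not_le)
  qed
  ultimately show ?thesis unfolding d_def by blast
qed

text \<open>The final size estimate of \<open>not_small_orbit\<close>, used with
  \<open>P = p ^ e\<close>. For \<open>P = 2 * k + 1\<close> one has \<open>m \<le> k\<close> and
  \<open>P < 2 ^ (k + 1)\<close>.\<close>

lemma odd_times_2_power_less:
  fixes P m :: nat
  assumes "odd P" "3 \<le> P" "2 * m \<le> P - 1"
  shows "P * 2 ^ m < 2 ^ P"
proof -
  obtain k where k: "P = 2 * k + 1" using assms by (elim oddE)
  have "2 * j + 3 < 2 ^ (j + 2)" for j :: nat by (induction j) auto
  from this [of "k - 1"] have "P < 2 ^ (k + 1)" using k assms by (cases k) auto
  moreover have "2 ^ m \<le> (2 :: nat) ^ k" using k assms by simp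
  ultimately have "P * 2 ^ m < 2 ^ (k + 1) * 2 ^ k" by (intro mult_less_le_imp_less) auto
  also have "\<dots> = 2 ^ P" by (simp only: k power_add [symmetric]) (simp add: mult_2)
  finally show ?thesis .
qed


section \<open>Orbits of small residues under multiplication by \<open>2 ^ r\<close>\<close>

text \<open>
  Reduction of \<open>B\<close> to residues modulo \<open>p\<^sup>s\<close> is a union of orbits under multiplication by \<open>2\<^sup>r\<close>, all
  of whose representatives are small. Exhibiting a suitable element of the subgroup generated
  by \<open>2\<^sup>r\<close> moves a small representative to a large one.
\<close>
locale small_orbit =
  fixes p s r :: nat and B :: "nat set"
  assumes p: "prime p" "odd p" and r: "2 \<le> r" and ne: "B \<noteq> {}"
    and pos: "x \<in> B \<Longrightarrow> 0 < x" and bound: "x \<in> B \<Longrightarrow> x * (2 ^ r - 1) \<le> p ^ s"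
    and cop: "x \<in> B \<Longrightarrow> coprime x p"
    and closed_mult: "x \<in> B \<Longrightarrow> \<exists>y\<in>B. [y = 2 ^ r * x] (mod p ^ s)"
begin

abbreviation d :: nat where "d \<equiv> ord (p ^ s) 2"

lemma d_pos: "0 < d"
  using p by simp

lemma pow_ge: "3 \<le> (2 :: nat) ^ r - 1"
proof -
  have "(2 :: nat) ^ 2 \<le> 2 ^ r" using r by (intro power_increasing) auto
  then show ?thesis by simp
qed

lemma less_modulus: "x \<in> B \<Longrightarrow> 3 * x \<le> p ^ s"
  using bound [of x] mult_le_mono2 [OF pow_ge, of x] by linarith

lemma finite_B: "finite B"
  by (rule finite_subset [of _ "{..p ^ s}"]) (use less_modulus in fastforce)+

lemma closed_power: "x \<in> B \<Longrightarrow> \<exists>y\<in>B. [y = 2 ^ (r * k) * x] (mod p ^ s)"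
proof (induction k)
  case (Suc k)
  then obtain y where y: "y \<in> B" "[y = 2 ^ (r * k) * x] (mod p ^ s)" by auto
  obtain z where z: "z \<in> B" "[z = 2 ^ r * y] (mod p ^ s)" using closed_mult [OF y(1)] by auto
  have "[z = 2 ^ r * (2 ^ (r * k) * x)] (mod p ^ s)"
    using z(2) cong_scalar_left [OF y(2)] by (rule cong_trans)
  then have "[z = 2 ^ (r * Suc k) * x] (mod p ^ s)"
    by (simp only: mult_Suc_right power_add mult.assoc)
  then show ?case using z(1) by auto
next
  case 0
  then show ?case by (intro bexI [of _ x]) auto
qed

text \<open>Passing to integers admits the negative multipliers that arise from an even
  order.\<close>

lemma closed_power_int:
  assumes "x \<in> B" "[2 ^ (r * k) = h] (mod int p ^ s)"
  shows "\<exists>y\<in>B. [int y = h * int x] (mod int p ^ s)"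
proof -
  obtain y where y: "y \<in> B" "[y = 2 ^ (r * k) * x] (mod p ^ s)"
    using closed_power [OF assms(1)] by blast
  have "[int y = 2 ^ (r * k) * int x] (mod int p ^ s)"
    using y(2) unfolding cong_int_iff [symmetric] by simp
  also have "[2 ^ (r * k) * int x = h * int x] (mod int p ^ s)"
    using assms(2) by (rule cong_scalar_right)
  finally show ?thesis using y(1) by blast
qed

text \<open>Otherwise \<open>g = gcd r d\<close> is below \<open>r\<close>, and by Bezout
  \<open>2 ^ g\<close> is a power of \<open>2 ^ r\<close> modulo \<open>p ^ s\<close>. Multiplying
  the largest element of \<open>B\<close> by \<open>2 ^ g\<close> stays below the modulus, since
  \<open>2 ^ g < 2 ^ r - 1\<close>, and so yields a larger element of \<open>B\<close>.\<close>

lemma r_dvd_ord: "r dvd d"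
proof (rule ccontr)
  define g where "g = gcd r d"
  assume "\<not> r dvd d"
  then have "g \<noteq> r" unfolding g_def by (metis gcd_dvd2)
  moreover have "g \<le> r" using r unfolding g_def by (intro gcd_le1_nat) auto
  ultimately have gr: "g \<le> r - 1" by simp
  have g0: "1 \<le> g" using r unfolding g_def by (simp add: Suc_le_eq)
  obtain k m where "r * k = d * m + g"
    using bezout_nat [of r d] r unfolding g_def by auto
  have pw: "[2 ^ (r * k) = (2 :: nat) ^ g] (mod p ^ s)"
  proof -
    have "[(2 ^ d) ^ m * 2 ^ g = (1 :: nat) ^ m * 2 ^ g] (mod p ^ s)"
      by (intro cong_mult cong_pow ord cong_refl)
    then show ?thesis by (simp add: \<open>r * k = d * m + g\<close> power_add power_mult)
  qed
  define x where "x = Max B"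
  have x: "x \<in> B" unfolding x_def using finite_B ne by (rule Max_in)
  obtain y where y: "y \<in> B" "[y = 2 ^ (r * k) * x] (mod p ^ s)" using closed_power [OF x] by blast
  have y2: "[y = 2 ^ g * x] (mod p ^ s)"
    using y(2) cong_scalar_right [OF pw] by (rule cong_trans)
  have "2 ^ g * x < p ^ s"
  proof -
    have "2 ^ g \<le> (2 :: nat) ^ (r - 1)" using gr by (intro power_increasing) auto
    also have "(2 :: nat) ^ (r - 1) < 2 ^ r - 1"
    proof -
      have "(2 :: nat) ^ r = 2 * 2 ^ (r - 1)" using r by (cases r) auto
      moreover have "2 ^ 1 \<le> (2 :: nat) ^ (r - 1)" using r by (intro power_increasing) auto
      ultimately show ?thesis by simp
    qed
    finally have "2 ^ g * x < (2 ^ r - 1) * x" using pos [OF x] by simp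
    also have "\<dots> \<le> p ^ s" using bound [OF x] by (simp add: mult.commute)
    finally show ?thesis .
  qed
  moreover have "y < p ^ s" using less_modulus [OF y(1)] pos [OF y(1)] by simp
  ultimately have "y = 2 ^ g * x" using y2 by (intro cong_less_modulus_unique_nat)
  moreover have "(2 :: nat) ^ 1 \<le> 2 ^ g" using g0 by (intro power_increasing) auto
  ultimately have "x < y" using pos [OF x] by simp
  moreover have "y \<le> x" unfolding x_def using finite_B y(1) by (rule Max_ge)
  ultimately show False by simp
qed

text \<open>For even \<open>d = r * w\<close>, the group generated by \<open>2 ^ r\<close> contains
  -1 if \<open>w\<close> is even, and \<open>- (2 ^ (r div 2))\<close> if \<open>w\<close> is odd.
  Both send a small residue to one too close to the modulus, except in the borderline case
  \<open>r = 2\<close>, \<open>p = 3\<close>.\<close>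

lemma odd_ord:
  assumes "p \<noteq> 2 ^ r - 1"
  shows "odd d"
proof
  assume ev: "even d"
  obtain w where w: "d = r * w" using r_dvd_ord by (elim dvdE)
  obtain x where x: "x \<in> B" using ne by auto
  have m1: "[2 ^ (d div 2) = (-1 :: int)] (mod int p ^ s)" by (rule pow_2_half_ord [OF p ev])
  show False
  proof (cases "even w")
    case True
    then have "[2 ^ (r * (w div 2)) = (-1 :: int)] (mod int p ^ s)"
      using m1 by (simp add: w div_mult_swap)
    then obtain y where y: "y \<in> B" "[int y = -1 * int x] (mod int p ^ s)"
      using closed_power_int [OF x] by blast
    \<comment> \<open>\<open>x\<close> and \<open>y\<close> are each at most a third of
      \<open>p ^ s\<close>, so their positive sum cannot be a multiple of it.\<close>
    have "int (p ^ s) dvd int (y + x)" using y(2) by (simp add: cong_iff_dvd_diff)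
    then have "p ^ s dvd y + x" by (simp only: int_dvd_int_iff)
    then have "p ^ s \<le> y + x" using pos [OF x] by (intro dvd_imp_le) auto
    then show False using less_modulus [OF x] less_modulus [OF y(1)] pos [OF x] by simp
  next
    case False
    then obtain j where j: "w = 2 * j + 1" by (elim oddE)
    have "even r" using ev False by (simp add: w)
    then obtain h where h: "r = 2 * h" by (elim evenE)
    define v where "v = (2 :: nat) ^ h"
    have v2: "2 ^ 1 \<le> v" unfolding v_def using h r by (intro power_increasing) auto
    have vv: "(v + 1) * (v - 1) = 2 ^ r - 1"
    proof -
      have "(2 :: nat) ^ r = v * v" unfolding v_def h by (simp only: mult_2 power_add)
      then show ?thesis by (simp only: add_mult_distrib diff_mult_distrib2)
    qed
    have "d div 2 = r * j + h" unfolding w j h by (simp add: algebra_simps)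
    then have e: "[2 ^ (r * j) * int v = -1] (mod int p ^ s)"
      using m1 by (simp add: power_add v_def)
    \<comment> \<open>One more factor \<open>v\<close> completes the exponent
      \<open>r * j + h\<close> to a multiple of \<open>r\<close>.\<close>
    have "[2 ^ (r * (j + 1)) = - int v] (mod int p ^ s)"
    proof -
      have "2 ^ (r * (j + 1)) = 2 ^ (r * j) * int v * int v"
        unfolding v_def h by (simp add: power_add mult_2 distrib_left)
      then show ?thesis using cong_scalar_right [OF e, of "int v"] by simp
    qed
    then obtain y where y: "y \<in> B" "[int y = - int v * int x] (mod int p ^ s)"
      using closed_power_int [OF x] by blast
    have "int (p ^ s) dvd int (y + v * x)" using y(2) by (simp add: cong_iff_dvd_diff)
    then have dv: "p ^ s dvd y + v * x" by (simp only: int_dvd_int_iff)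
    then have ge: "p ^ s \<le> y + v * x" using pos [OF y(1)] by (intro dvd_imp_le) auto
    have "(v + 1) * ((y + v * x) * (v - 1)) = y * (2 ^ r - 1) + v * (x * (2 ^ r - 1))"
      unfolding vv [symmetric] by (simp add: algebra_simps)
    also have "\<dots> \<le> p ^ s + v * p ^ s"
      using bound [OF x] bound [OF y(1)] by (intro add_mono mult_le_mono2) auto
    also have "\<dots> = (v + 1) * p ^ s" by simp
    finally have le: "(y + v * x) * (v - 1) \<le> p ^ s" by (simp only: mult_le_cancel1)
    \<comment> \<open>The sum \<open>y + v * x\<close> is at least \<open>p ^ s\<close> but at most
      \<open>p ^ s\<close> divided by \<open>v - 1\<close>. Only \<open>v = 2\<close> survives, with
      equality throughout, which leads to the excluded prime \<open>3 = 2 ^ 2 - 1\<close>.\<close>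
    have "v - 1 \<le> 1"
    proof (rule ccontr)
      assume "\<not> v - 1 \<le> 1"
      then have "(y + v * x) * 2 \<le> (y + v * x) * (v - 1)" by (intro mult_le_mono2) auto
      then show False using le ge pos [OF y(1)] by simp
    qed
    then have v: "v = 2" using v2 by simp
    then have "h = 1" unfolding v_def by (metis power_inject_exp power_one_right one_less_numeral_iff semiring_norm(76))
    then have r2: "r = 2" using h by simp
    have "y + 2 * x = p ^ s" using ge le v by simp
    then have "3 * x = p ^ s" using less_modulus [OF x] less_modulus [OF y(1)] by simp
    then have "3 dvd p ^ s" by (metis dvd_triv_left)
    then have "3 dvd p" by (rule prime_dvd_power_nat [rotated]) simp
    then have "p = 3" using primes_dvd_imp_eq [of 3 p] p by simp
    then show False using assms r2 by simp
  qed
qed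

lemma ord_dvd_totient: "d dvd p ^ (s - 1) * (p - 1)"
proof (cases s)
  case (Suc k)
  have "d dvd totient (p ^ s)" using p by (intro order_divides_totient) simp
  then show ?thesis using p unfolding Suc totient_prime_power_Suc [OF p(1)] by simp
qed simp

text \<open>Since \<open>r * ord p 2\<close> comes out odd, the hypothesis leaves
  \<open>\<not> r dvd p - 1\<close>. As \<open>r\<close> divides
  \<open>p ^ (s - 1) * (p - 1)\<close>, this gives \<open>p dvd r\<close>, so \<open>2 ^ r\<close>
  is large compared with \<open>p\<close>. The two cases separate whether \<open>p\<close> also
  divides \<open>d div r\<close>.\<close>

theorem not_small_orbit:
  assumes "p \<noteq> 2 ^ r - 1" and hyp: "even (r * ord p 2) \<or> \<not> r dvd (p - 1)"
  shows False
proof -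
  obtain x where x: "x \<in> B" using ne by auto
  obtain w where w: "d = r * w" using r_dvd_ord by (elim dvdE)
  have odd: "odd d" using assms(1) by (rule odd_ord)
  have s: "s \<ge> 1"
    using less_modulus [OF x] pos [OF x] by (cases s) auto
  have "ord p 2 dvd d"
  proof -
    have "[(2 :: nat) ^ d = 1] (mod p)"
      by (rule cong_dvd_modulus_nat [OF ord [of 2 "p ^ s"]]) (use s in simp)
    then show ?thesis by (simp only: ord_divides)
  qed
  then have "odd (r * ord p 2)" using odd w dvd_trans by (metis even_mult_iff)
  then have nd: "\<not> r dvd p - 1" using hyp by simp
  have pr: "p dvd r"
  proof (rule ccontr)
    assume "\<not> p dvd r"
    then have "coprime r (p ^ (s - 1))" using p by (simp add: prime_imp_coprime coprime_commute)
    moreover have "r dvd p ^ (s - 1) * (p - 1)" using r_dvd_ord ord_dvd_totient by (rule dvd_trans)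
    ultimately show False using nd by (simp add: coprime_dvd_mult_right_iff)
  qed
  have one_less: "1 < p" using p prime_gt_1_nat by blast
  show False
  proof (cases "p dvd w")
    case True
    then obtain j where j: "w = p * j" by (elim dvdE)
    \<comment> \<open>\<open>a\<close> is an element of order \<open>p\<close> that is trivial
      modulo \<open>p ^ (s - 1)\<close>. The bound \<open>p \<le> 2 ^ r - 1\<close> confines
      \<open>B\<close> to \<open>{1..p ^ (s - 1)}\<close>, so multiplication by \<open>a\<close>
      must fix \<open>x\<close>, which contradicts the order of 2.\<close>
    define a where "a = (2 :: nat) ^ (r * j)"
    have "a ^ p = 2 ^ d" by (simp add: a_def w j ac_simps flip: power_mult)
    then have "[a ^ p = 1] (mod p ^ s)" using ord by simp
    then have a1: "[a = 1] (mod p ^ (s - 1))" by (rule cong_pow_prime_descent [OF p])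
    obtain y where y: "y \<in> B" "[y = a * x] (mod p ^ s)"
      using closed_power [OF x] unfolding a_def by blast
    have "[y = a * x] (mod p ^ (s - 1))"
      using y(2) by (rule cong_dvd_modulus_nat) (simp add: le_imp_power_dvd)
    also have "[a * x = 1 * x] (mod p ^ (s - 1))" using a1 by (rule cong_scalar_right)
    finally have yx: "[y = x] (mod p ^ (s - 1))" by simp
    have le: "z \<le> p ^ (s - 1)" if "z \<in> B" for z
    proof -
      have "p \<le> r" using pr r by (intro dvd_imp_le) auto
      also have "r \<le> 2 ^ r - 1" using less_exp [of r] by linarith
      finally have "z * p \<le> p ^ s" using bound [OF that] by (meson le_trans mult_le_mono2)
      also have "p ^ s = p ^ (s - 1) * p" using s by (cases s) auto
      finally show ?thesis using one_less by simp
    qed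
    have "y = x" by (rule cong_bounded_imp_eq [OF yx]) (use x y(1) pos le in auto)
    then have "[a * x = 1 * x] (mod p ^ s)" using y(2) by (simp add: cong_sym_eq)
    then have "[a = 1] (mod p ^ s)"
      using cop [OF x] by (subst (asm) cong_mult_rcancel_nat) auto
    then have "d dvd r * j" unfolding a_def ord_divides .
    moreover have "0 < r * j" using d_pos w j by auto
    ultimately have "d \<le> r * j" by (rule dvd_imp_le)
    then show False using \<open>0 < r * j\<close> one_less unfolding w j by simp
  next
    case False
    define e where "e = multiplicity p r"
    have "r \<noteq> 0" "\<not> is_unit p" using r p by auto
    then obtain r' where r': "r = p ^ e * r'" "\<not> p dvd r'"
      unfolding e_def by (rule multiplicity_decompose')
    define f where "f = r' * w"
    have d: "d = p ^ e * f" by (simp add: w r' f_def)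
    have pf: "\<not> p dvd f" using False r'(2) p by (simp add: f_def prime_dvd_mult_iff)
    have f0: "0 < f" using d d_pos by auto
    have "f dvd p ^ (s - 1) * (p - 1)" using d ord_dvd_totient dvd_mult_right by metis
    moreover have "coprime f (p ^ (s - 1))" using prime_imp_coprime [OF p(1) pf] by (simp add: coprime_commute)
    ultimately have "f dvd p - 1" by (simp add: coprime_dvd_mult_right_iff)
    moreover have "odd f" using odd d by simp
    \<comment> \<open>The odd number \<open>f\<close> divides the even number \<open>p - 1\<close>;
      the gained factor 2 is what the size estimate requires.\<close>
    ultimately have "2 * f dvd p - 1"
      using p by (intro divides_mult) auto
    then have fp: "2 * f \<le> p - 1" using one_less by (intro dvd_imp_le) auto
    have e: "e \<ge> 1"
      using pr r'(2) by (cases "e = 0") (use r'(1) in auto)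
    then have pe: "p \<le> p ^ e" using one_less by (metis power_increasing power_one_right less_imp_le)
    have p3: "3 \<le> p" using p one_less by (cases "p = 2") auto
    have "[(2 ^ f) ^ (p ^ e) = (1 :: nat)] (mod p ^ s)"
      using ord [of 2 "p ^ s"] by (simp add: d mult.commute flip: power_mult)
    then have "[(2 :: nat) ^ f = 1] (mod p ^ (s - e))"
      by (rule cong_pow_prime_power_descent [OF p])
    then have "p ^ (s - e) dvd 2 ^ f - (1 :: nat)"
      by (subst (asm) cong_altdef_nat) auto
    moreover have f1: "2 ^ f - (1 :: nat) > 0" using f0 one_less_power [of "2 :: nat" f] by simp
    ultimately have "p ^ (s - e) \<le> 2 ^ f - 1" by (rule dvd_imp_le)
    \<comment> \<open>The summand 1, scaled by \<open>p ^ e\<close>, later absorbs the 1 subtracted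
      in \<open>2 ^ r - 1\<close>.\<close>
    then have lt: "p ^ (s - e) + 1 \<le> 2 ^ f" using f1 by linarith
    \<comment> \<open>Only an inequality, since \<open>s - e\<close> is truncated to 0 when
      \<open>e > s\<close>.\<close>
    have "p ^ s \<le> p ^ e * p ^ (s - e)"
      unfolding power_add [symmetric] using one_less by (intro power_increasing) auto
    then have "p ^ s + p ^ e \<le> p ^ e * 2 ^ f" using mult_le_mono2 [OF lt, of "p ^ e"] by simp
    moreover have "p ^ e * 2 ^ f < 2 ^ (p ^ e)"
      by (rule odd_times_2_power_less) (use p p3 pe fp in auto)
    moreover have "(2 :: nat) ^ (p ^ e) \<le> 2 ^ r"
      using r'  \<open>r \<noteq> 0\<close> by (intro power_increasing) auto
    ultimately have "p ^ s < 2 ^ r - 1" using pe one_less by linarith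
    moreover have "2 ^ r - 1 \<le> x * (2 ^ r - 1)" using pos [OF x] by simp
    ultimately show False using bound [OF x] by linarith
  qed
qed

end


section \<open>Integer cycles and their reduction to small orbits\<close>

text \<open>A finite forward-invariant set of nonzero integers exists exactly when there is a nonzero cycle.\<close>
definition integer_trap :: "nat \<Rightarrow> int \<Rightarrow> int set \<Rightarrow> bool" where
  "integer_trap r t C \<longleftrightarrow> finite C \<and> C \<noteq> {} \<and> 0 \<notin> C \<and>
     (\<forall>z\<in>C. \<exists>z'\<in>C. 2 ^ r * z' = z \<or> 2 ^ r * z' = z + t)"

text \<open>On a nonempty invariant subset of least cardinality, a successor function must be
  surjective, so every element also has a predecessor there.\<close>

lemma integer_trap_cyclic:
  assumes "integer_trap r t C"
  obtains D where "integer_trap r t D" "\<forall>z'\<in>D. \<exists>z\<in>D. 2 ^ r * z' = z \<or> 2 ^ r * z' = z + t"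
proof -
  have "\<forall>z\<in>C. \<exists>z'. z' \<in> C \<and> (2 ^ r * z' = z \<or> 2 ^ r * z' = z + t)"
    using assms unfolding integer_trap_def by blast
  then obtain f where "\<forall>z\<in>C. f z \<in> C \<and> (2 ^ r * f z = z \<or> 2 ^ r * f z = z + t)"
    unfolding bchoice_iff by blast
  then have f: "f z \<in> C" "2 ^ r * f z = z \<or> 2 ^ r * f z = z + t" if "z \<in> C" for z
    using that by blast+
  define P where "P D \<longleftrightarrow> D \<subseteq> C \<and> D \<noteq> {} \<and> f ` D \<subseteq> D" for D
  have PC: "P C" using assms f unfolding P_def integer_trap_def by auto
  obtain D where D: "P D" and min_card: "\<forall>E. P E \<longrightarrow> card D \<le> card E"
    using ex_has_least_nat [of P C card] PC by blast
  have fin: "finite D" using D assms unfolding P_def integer_trap_def by (auto intro: finite_subset)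
  have "P (f ` D)" using D unfolding P_def by auto
  then have "card D \<le> card (f ` D)" using min_card by blast
  then have fD: "f ` D = D" using D fin unfolding P_def by (intro card_seteq) auto
  have DC: "D \<subseteq> C" "D \<noteq> {}" using D unfolding P_def by auto
  show thesis
  proof (rule that)
    show "integer_trap r t D"
      unfolding integer_trap_def
    proof (intro conjI ballI)
      show "0 \<notin> D" using assms DC unfolding integer_trap_def by blast
      fix z assume "z \<in> D"
      then show "\<exists>z'\<in>D. 2 ^ r * z' = z \<or> 2 ^ r * z' = z + t"
        using f(2) [of z] DC fD by (intro bexI [of _ "f z"]) auto
    qed (use fin DC in auto)
    show "\<forall>z'\<in>D. \<exists>z\<in>D. 2 ^ r * z' = z \<or> 2 ^ r * z' = z + t"
    proof
      fix z' assume "z' \<in> D"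
      then obtain z where "z \<in> D" "z' = f z" using fD by blast
      then show "\<exists>z\<in>D. 2 ^ r * z' = z \<or> 2 ^ r * z' = z + t"
        using f(2) [of z] DC by (intro bexI [of _ z]) auto
    qed
  qed
qed

text \<open>Compare the minimum and the maximum of \<open>D\<close> with their predecessors:
  \<open>2 ^ r * Min D \<ge> Min D\<close> and \<open>2 ^ r * Max D \<le> Max D + t\<close>. Strict
  positivity comes from \<open>0 \<notin> D\<close>.\<close>

lemma integer_trap_bounds:
  assumes r: "2 \<le> r" and t: "0 < t" and D: "integer_trap r t D"
    and bwd: "\<forall>z'\<in>D. \<exists>z\<in>D. 2 ^ r * z' = z \<or> 2 ^ r * z' = z + t" and z: "z \<in> D"
  shows "0 < z" "z * (2 ^ r - 1) \<le> t"
proof -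
  have fin: "finite D" "D \<noteq> {}" using D by (auto simp: integer_trap_def)
  have q: "(2 :: int) ^ r - 1 \<ge> 1" using power_increasing [of 1 r "2 :: int"] r by simp
  have "Min D \<in> D" "Max D \<in> D" using fin by auto
  obtain x where x: "x \<in> D" "2 ^ r * Min D = x \<or> 2 ^ r * Min D = x + t" using bwd \<open>Min D \<in> D\<close> by blast
  have "Min D \<le> x" using fin x by simp
  then have "0 \<le> (2 ^ r - 1) * Min D" using x(2) t by (auto simp: left_diff_distrib)
  then have "0 \<le> Min D" using q by (simp add: zero_le_mult_iff)
  then have "0 \<le> z" using fin z Min_le by (meson order_trans)
  then show "0 < z" using D z unfolding integer_trap_def by (metis order_le_less)
  obtain y where y: "y \<in> D" "2 ^ r * Max D = y \<or> 2 ^ r * Max D = y + t" using bwd \<open>Max D \<in> D\<close> by blast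
  have "y \<le> Max D" using fin y by simp
  then have "Max D * (2 ^ r - 1) \<le> t" using y(2) t by (auto simp: algebra_simps)
  moreover have "z * (2 ^ r - 1) \<le> Max D * (2 ^ r - 1)" using fin z q by (intro mult_right_mono) auto
  ultimately show "z * (2 ^ r - 1) \<le> t" by simp
qed

lemma no_integer_trap_1:
  assumes r: "2 \<le> r"
  shows "\<not> integer_trap r 1 C"
proof
  assume "integer_trap r 1 C"
  then obtain D where D: "integer_trap r 1 D" "\<forall>z'\<in>D. \<exists>z\<in>D. 2 ^ r * z' = z \<or> 2 ^ r * z' = z + 1"
    by (rule integer_trap_cyclic)
  then obtain z where z: "z \<in> D" by (auto simp: integer_trap_def)
  have "0 < z" "z * (2 ^ r - 1) \<le> 1" using integer_trap_bounds [OF r _ D z] by auto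
  moreover have "(3 :: int) \<le> 2 ^ r - 1" using power_increasing [of 2 r "2 :: int"] r by simp
  then have "z * 3 \<le> z * (2 ^ r - 1)" using \<open>0 < z\<close> by (intro mult_left_mono) auto
  ultimately show False by simp
qed

text \<open>Divide a cycle by the largest power \<open>p ^ a\<close> that divides one of its
  elements, keeping only the elements divisible by it. Maximality of \<open>a\<close> makes the
  quotients prime to \<open>p\<close>, and they form a \<open>small_orbit\<close> modulo
  \<open>p ^ (n - a)\<close>.\<close>

lemma no_integer_trap_prime_power:
  assumes r: "2 \<le> r" and p: "prime p" "odd p" "p \<noteq> 2 ^ r - 1"
    and hyp: "even (r * ord p 2) \<or> \<not> r dvd (p - 1)"
  shows "\<not> integer_trap r (int p ^ n) C"
proof
  assume "integer_trap r (int p ^ n) C"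
  then obtain D where D: "integer_trap r (int p ^ n) D"
      "\<forall>z'\<in>D. \<exists>z\<in>D. 2 ^ r * z' = z \<or> 2 ^ r * z' = z + int p ^ n"
    by (rule integer_trap_cyclic)
  have t: "0 < int p ^ n" using p by (simp add: prime_gt_0_nat)
  note bd = integer_trap_bounds [OF r t D]
  have q3: "(3 :: int) \<le> 2 ^ r - 1" using power_increasing [of 2 r "2 :: int"] r by simp
  have lt: "z < int p ^ n" if "z \<in> D" for z
  proof -
    have "z * 3 \<le> z * (2 ^ r - 1)" using bd [OF that] q3 by (intro mult_left_mono) auto
    then show ?thesis using bd [OF that] by linarith
  qed
  have le_n: "a < n" if "z \<in> D" "int p ^ a dvd z" for z a
  proof (rule ccontr)
    assume "\<not> a < n"
    then have "int p ^ n dvd z" using that(2) by (meson dvd_trans le_imp_power_dvd not_less)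
    then show False using bd(1) [OF that(1)] lt [OF that(1)] zdvd_imp_le by fastforce
  qed
  define A where "A = {a. \<exists>z\<in>D. int p ^ a dvd z}"
  have "A \<subseteq> {..<n}" using le_n by (auto simp: A_def)
  then have finA: "finite A" by (rule finite_subset) simp
  have "0 \<in> A" using D(1) by (auto simp: A_def integer_trap_def)
  define a where "a = Max A"
  have "a \<in> A" unfolding a_def using finA \<open>0 \<in> A\<close> by (intro Max_in) auto
  then obtain z0 where z0: "z0 \<in> D" "int p ^ a dvd z0" by (auto simp: A_def)
  have an: "a < n" using le_n z0 by blast
  have pn: "int p ^ n = int p ^ a * int p ^ (n - a)" using an by (simp flip: power_add)
  have pa: "0 < int p ^ a" using p by (simp add: prime_gt_0_nat)
  define B where "B = {u :: nat. int p ^ a * int u \<in> D}"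
  have "small_orbit p (n - a) r B"
  proof
    show "B \<noteq> {}"
    proof -
      obtain u where u: "z0 = int p ^ a * u" using z0 by (elim dvdE)
      then have "0 < u" using bd(1) [OF z0(1)] pa by (simp add: zero_less_mult_iff)
      then have "nat u \<in> B" using z0(1) u by (simp add: B_def)
      then show ?thesis by auto
    qed
  next
    fix u assume "u \<in> B"
    then have u: "int p ^ a * int u \<in> D" by (simp add: B_def)
    show "0 < u" using bd(1) [OF u] by (cases u) auto
    have "int p ^ a * (int u * (2 ^ r - 1)) \<le> int p ^ a * int p ^ (n - a)"
      using bd(2) [OF u] by (simp add: pn mult.assoc)
    then have "int u * (2 ^ r - 1) \<le> int p ^ (n - a)" using pa by simp
    also have "int u * (2 ^ r - 1) = int (u * (2 ^ r - 1))" by (simp add: of_nat_diff)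
    finally have "int (u * (2 ^ r - 1)) \<le> int (p ^ (n - a))" by simp
    then show "u * (2 ^ r - 1) \<le> p ^ (n - a)" by (simp only: of_nat_le_iff)
    have "\<not> p dvd u"
    proof
      assume "p dvd u"
      then have "int p ^ a * int p dvd int p ^ a * int u" by (intro mult_dvd_mono) auto
      then have "int p ^ Suc a dvd int p ^ a * int u" by (simp add: mult.commute)
      then have "Suc a \<in> A" using u unfolding A_def by blast
      then show False using Max_ge [OF finA, of "Suc a"] by (simp add: a_def)
    qed
    then show "coprime u p" using prime_imp_coprime [OF p(1), of u] by (simp add: coprime_commute)
    \<comment> \<open>Multiplication by \<open>2 ^ r\<close> is realised by predecessors. As
      \<open>a < n\<close>, subtracting \<open>c * int p ^ n\<close> with \<open>c\<close> 0 or 1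
      preserves divisibility by \<open>p ^ a\<close>.\<close>
    obtain z where z: "z \<in> D" "2 ^ r * (int p ^ a * int u) = z \<or> 2 ^ r * (int p ^ a * int u) = z + int p ^ n"
      using D(2) u by blast
    obtain c where c: "z = 2 ^ r * (int p ^ a * int u) - c * int p ^ n"
      using z(2) by (elim disjE) (metis diff_zero mult_zero_left, metis add_diff_cancel_right' mult_1)
    define v where "v = 2 ^ r * int u - c * int p ^ (n - a)"
    have zv: "z = int p ^ a * v" unfolding c v_def pn by (simp add: algebra_simps)
    then have "0 < v" using bd(1) [OF z(1)] pa by (simp add: zero_less_mult_iff)
    then have vB: "nat v \<in> B" using z(1) zv by (simp add: B_def)
    have "[v = 2 ^ r * int u] (mod int p ^ (n - a))"
      unfolding v_def by (simp add: cong_iff_dvd_diff)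
    then have "[int (nat v) = int (2 ^ r * u)] (mod int (p ^ (n - a)))" using \<open>0 < v\<close> by simp
    then have "[nat v = 2 ^ r * u] (mod p ^ (n - a))" by (simp only: cong_int_iff)
    then show "\<exists>y\<in>B. [y = 2 ^ r * u] (mod p ^ (n - a))" using vB by blast
  qed (use p r in auto)
  then show False by (rule small_orbit.not_small_orbit [OF _ p(3) hyp])
qed


section \<open>Exponentials in \<open>L\<^sup>2\<close>\<close>

lemma expo_add: "expo (l + m) x = expo l x * expo m x"
  unfolding expo_def by (simp add: exp_add [symmetric] algebra_simps)

lemma cnj_expo: "cnj (expo l x) = expo (- l) x"
  unfolding expo_def exp_cnj by simp

lemma expo_mult_cnj: "expo l x * cnj (expo m x) = expo (l - m) x"
  by (simp add: cnj_expo flip: expo_add)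

lemma expo_0 [simp]: "expo 0 x = 1"
  by (simp add: expo_def)

lemma expo_eq_cis: "expo l x = cis (- 2 * pi * l * x)"
  by (simp add: expo_def cis_conv_exp mult_ac)

lemma norm_expo [simp]: "cmod (expo l x) = 1"
  by (simp add: expo_eq_cis)

lemma continuous_expo [continuous_intros]: "continuous_on A (expo l)"
  unfolding expo_def by (intro continuous_intros)

lemma measurable_expo [measurable]: "expo l \<in> borel_measurable borel"
  by (intro borel_measurable_continuous_onI continuous_expo)

text \<open>Frequencies are arbitrary reals, so products remain in the class and its real-valued
  members form an algebra suitable for Stone-Weierstrass.\<close>

inductive trig_poly :: "(real \<Rightarrow> complex) \<Rightarrow> bool" where
  expo: "trig_poly (\<lambda>x. c * expo l x)"
| add: "trig_poly f \<Longrightarrow> trig_poly g \<Longrightarrow> trig_poly (\<lambda>x. f x + g x)"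

lemma trig_poly_mult:
  assumes "trig_poly f" "trig_poly g"
  shows "trig_poly (\<lambda>x. f x * g x)"
  using assms
proof (induction f)
  case (expo c l)
  then show ?case
  proof (induction g)
    case (expo c' l')
    have "(\<lambda>x. c * expo l x * (c' * expo l' x)) = (\<lambda>x. (c * c') * expo (l + l') x)"
      by (simp add: expo_add fun_eq_iff)
    then show ?case by (simp add: trig_poly.expo)
  qed (simp add: distrib_left trig_poly.add)
qed (simp add: distrib_right trig_poly.add)

lemma trig_poly_const: "trig_poly (\<lambda>x. c)"
  using trig_poly.expo [of c 0] by simp

lemma trig_poly_sin: "trig_poly (\<lambda>x. of_real (sin (2 * pi * l * x)))"
proof -
  have "of_real (sin (2 * pi * l * x)) = (- \<i> / 2) * expo (- l) x + (\<i> / 2) * expo l x" for x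
    by (simp add: expo_eq_cis complex_eq_iff)
  then show ?thesis by (simp only: trig_poly.intros)
qed

text \<open>This stands in for the triangle inequality of \<open>L^2\<close>; its factor 2 is the
  reason for the shares \<open>\<epsilon> / 4\<close> below.\<close>

lemma norm_add_square_le: "(cmod (a + b))\<^sup>2 \<le> 2 * (cmod a)\<^sup>2 + 2 * (cmod b)\<^sup>2"
proof -
  have "(cmod (a + b))\<^sup>2 \<le> (cmod a + cmod b)\<^sup>2"
    by (intro power_mono norm_triangle_ineq) auto
  also have "\<dots> \<le> 2 * (cmod a)\<^sup>2 + 2 * (cmod b)\<^sup>2"
    using sum_squares_bound [of "cmod a" "cmod b"] by (simp add: power2_sum)
  finally show ?thesis .
qed

section \<open>Closed linear spans of exponentials\<close>

context real_distribution
begin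

lemma square_integrable_bounded:
  assumes [measurable]: "f \<in> borel_measurable borel" and "\<And>x. cmod (f x) \<le> B"
  shows "square_integrable M f"
  unfolding square_integrable_def
proof
  show "integrable M (\<lambda>x. (cmod (f x))\<^sup>2)"
    by (rule integrable_const_bound [of _ "B\<^sup>2"]) (use assms in \<open>auto intro!: power_mono\<close>)
qed measurable

lemma square_integrable_add:
  assumes "square_integrable M f" "square_integrable M g"
  shows "square_integrable M (\<lambda>x. f x + g x)"
  unfolding square_integrable_def
proof
  have [measurable]: "f \<in> borel_measurable M" "g \<in> borel_measurable M"
    using assms by (auto simp: square_integrable_def)
  show "(\<lambda>x. f x + g x) \<in> borel_measurable M" by measurable
  show "integrable M (\<lambda>x. (cmod (f x + g x))\<^sup>2)"
  proof (rule Bochner_Integration.integrable_bound)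
    show "integrable M (\<lambda>x. 2 * (cmod (f x))\<^sup>2 + 2 * (cmod (g x))\<^sup>2)"
      using assms by (auto simp: square_integrable_def)
  qed (auto simp: norm_add_square_le)
qed

lemma square_integrable_cmult:
  "square_integrable M f \<Longrightarrow> square_integrable M (\<lambda>x. c * f x)"
  by (auto simp: square_integrable_def norm_mult power_mult_distrib)

lemma square_integrable_diff:
  assumes "square_integrable M f" "square_integrable M g"
  shows "square_integrable M (\<lambda>x. f x - g x)"
  using square_integrable_add [OF assms(1) square_integrable_cmult [OF assms(2), of "-1"]] by simp

lemma integral_square_add_le:
  assumes "square_integrable M f" "square_integrable M g"
  shows "(\<integral>x. (cmod (f x + g x))\<^sup>2 \<partial>M) \<le> 2 * (\<integral>x. (cmod (f x))\<^sup>2 \<partial>M) + 2 * (\<integral>x. (cmod (g x))\<^sup>2 \<partial>M)"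
proof -
  have "(\<integral>x. (cmod (f x + g x))\<^sup>2 \<partial>M) \<le> (\<integral>x. 2 * (cmod (f x))\<^sup>2 + 2 * (cmod (g x))\<^sup>2 \<partial>M)"
    by (rule integral_mono)
      (use assms square_integrable_add [OF assms] in \<open>auto simp: square_integrable_def norm_add_square_le\<close>)
  then show ?thesis using assms by (simp add: square_integrable_def)
qed

definition closed_span :: "real set \<Rightarrow> (real \<Rightarrow> complex) \<Rightarrow> bool" where
  "closed_span \<Lambda> f \<longleftrightarrow> square_integrable M f \<and>
     (\<forall>\<epsilon>>0. \<exists>F c. finite F \<and> F \<subseteq> \<Lambda> \<and> (\<integral>x. (cmod (f x - (\<Sum>l\<in>F. c l * expo l x)))\<^sup>2 \<partial>M) < \<epsilon>)"

lemma square_integrable_expo_sum: "square_integrable M (\<lambda>x. \<Sum>l\<in>F. c l * expo l x)"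
proof (rule square_integrable_bounded)
  show "cmod (\<Sum>l\<in>F. c l * expo l x) \<le> (\<Sum>l\<in>F. cmod (c l))" for x
    by (rule order_trans [OF norm_sum]) (simp add: norm_mult)
qed measurable

lemma closed_span_limit:
  assumes f: "square_integrable M f"
    and lim: "\<And>\<epsilon>. \<epsilon> > 0 \<Longrightarrow> \<exists>g. closed_span \<Lambda> g \<and> (\<integral>x. (cmod (f x - g x))\<^sup>2 \<partial>M) < \<epsilon>"
  shows "closed_span \<Lambda> f"
  unfolding closed_span_def
proof (intro conjI allI impI f)
  fix \<epsilon> :: real assume "\<epsilon> > 0"
  then have e: "\<epsilon> / 4 > 0" by simp
  obtain g where g: "closed_span \<Lambda> g" "(\<integral>x. (cmod (f x - g x))\<^sup>2 \<partial>M) < \<epsilon> / 4"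
    using lim [OF e] by blast
  obtain F c where F: "finite F" "F \<subseteq> \<Lambda>" "(\<integral>x. (cmod (g x - (\<Sum>l\<in>F. c l * expo l x)))\<^sup>2 \<partial>M) < \<epsilon> / 4"
    using g(1) e unfolding closed_span_def by blast
  have gs: "square_integrable M g" using g(1) by (simp add: closed_span_def)
  have "(\<integral>x. (cmod ((f x - g x) + (g x - (\<Sum>l\<in>F. c l * expo l x))))\<^sup>2 \<partial>M)
      \<le> 2 * (\<integral>x. (cmod (f x - g x))\<^sup>2 \<partial>M) + 2 * (\<integral>x. (cmod (g x - (\<Sum>l\<in>F. c l * expo l x)))\<^sup>2 \<partial>M)"
    by (intro integral_square_add_le square_integrable_diff f gs square_integrable_expo_sum)
  then have "(\<integral>x. (cmod (f x - (\<Sum>l\<in>F. c l * expo l x)))\<^sup>2 \<partial>M) < \<epsilon>"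
    using g(2) F(3) by simp
  then show "\<exists>F c. finite F \<and> F \<subseteq> \<Lambda> \<and> (\<integral>x. (cmod (f x - (\<Sum>l\<in>F. c l * expo l x)))\<^sup>2 \<partial>M) < \<epsilon>"
    using F by blast
qed

lemma closed_span_add:
  assumes "closed_span \<Lambda> f" "closed_span \<Lambda> g"
  shows "closed_span \<Lambda> (\<lambda>x. f x + g x)"
  unfolding closed_span_def
proof (intro conjI allI impI)
  have sq: "square_integrable M f" "square_integrable M g"
    using assms by (simp_all add: closed_span_def)
  then show "square_integrable M (\<lambda>x. f x + g x)" by (rule square_integrable_add)
  fix \<epsilon> :: real assume "\<epsilon> > 0"
  then have e: "\<epsilon> / 4 > 0" by simp
  obtain F c where F: "finite F" "F \<subseteq> \<Lambda>" "(\<integral>x. (cmod (f x - (\<Sum>l\<in>F. c l * expo l x)))\<^sup>2 \<partial>M) < \<epsilon> / 4"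
    using assms(1) e unfolding closed_span_def by blast
  obtain G d where G: "finite G" "G \<subseteq> \<Lambda>" "(\<integral>x. (cmod (g x - (\<Sum>l\<in>G. d l * expo l x)))\<^sup>2 \<partial>M) < \<epsilon> / 4"
    using assms(2) e unfolding closed_span_def by blast
  \<comment> \<open>On the overlap of \<open>F\<close> and \<open>G\<close> the coefficients add up;
    outside its own set each contributes 0.\<close>
  define h where "h l = (if l \<in> F then c l else 0) + (if l \<in> G then d l else 0)" for l
  have "(\<Sum>l\<in>F \<union> G. h l * expo l x) = (\<Sum>l\<in>F. c l * expo l x) + (\<Sum>l\<in>G. d l * expo l x)" for x
  proof -
    have "(\<Sum>l\<in>F \<union> G. h l * expo l x) = (\<Sum>l\<in>F \<union> G. if l \<in> F then c l * expo l x else 0)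
        + (\<Sum>l\<in>F \<union> G. if l \<in> G then d l * expo l x else 0)"
      unfolding sum.distrib [symmetric] by (intro sum.cong) (auto simp: h_def distrib_right)
    also have "(\<Sum>l\<in>F \<union> G. if l \<in> F then c l * expo l x else 0) = (\<Sum>l\<in>F. c l * expo l x)"
      using F G by (intro sum.mono_neutral_cong_right) auto
    also have "(\<Sum>l\<in>F \<union> G. if l \<in> G then d l * expo l x else 0) = (\<Sum>l\<in>G. d l * expo l x)"
      using F G by (intro sum.mono_neutral_cong_right) auto
    finally show ?thesis .
  qed
  then have eq: "f x + g x - (\<Sum>l\<in>F \<union> G. h l * expo l x)
      = (f x - (\<Sum>l\<in>F. c l * expo l x)) + (g x - (\<Sum>l\<in>G. d l * expo l x))" for x
    by simp
  have "(\<integral>x. (cmod (f x + g x - (\<Sum>l\<in>F \<union> G. h l * expo l x)))\<^sup>2 \<partial>M)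
      \<le> 2 * (\<integral>x. (cmod (f x - (\<Sum>l\<in>F. c l * expo l x)))\<^sup>2 \<partial>M) + 2 * (\<integral>x. (cmod (g x - (\<Sum>l\<in>G. d l * expo l x)))\<^sup>2 \<partial>M)"
    unfolding eq by (intro integral_square_add_le square_integrable_diff sq square_integrable_expo_sum)
  then have "(\<integral>x. (cmod (f x + g x - (\<Sum>l\<in>F \<union> G. h l * expo l x)))\<^sup>2 \<partial>M) < \<epsilon>"
    using F(3) G(3) by simp
  then show "\<exists>F c. finite F \<and> F \<subseteq> \<Lambda> \<and> (\<integral>x. (cmod (f x + g x - (\<Sum>l\<in>F. c l * expo l x)))\<^sup>2 \<partial>M) < \<epsilon>"
    using F(1,2) G(1,2) by (intro exI [of _ "F \<union> G"] exI [of _ h]) auto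
qed

lemma closed_span_0: "closed_span \<Lambda> (\<lambda>x. 0)"
  unfolding closed_span_def
  by (auto intro!: square_integrable_bounded [of _ 0] exI [of _ "{}"])

lemma closed_span_cmult:
  assumes "closed_span \<Lambda> f"
  shows "closed_span \<Lambda> (\<lambda>x. a * f x)"
proof (cases "a = 0")
  case True
  then show ?thesis by (simp add: closed_span_0)
next
  case False
  show ?thesis
    unfolding closed_span_def
  proof (intro conjI allI impI)
    show "square_integrable M (\<lambda>x. a * f x)"
      using assms by (auto simp: closed_span_def intro: square_integrable_cmult)
    fix \<epsilon> :: real assume "\<epsilon> > 0"
    then have e: "\<epsilon> / (cmod a)\<^sup>2 > 0" using False by simp
    obtain F c where F: "finite F" "F \<subseteq> \<Lambda>" "(\<integral>x. (cmod (f x - (\<Sum>l\<in>F. c l * expo l x)))\<^sup>2 \<partial>M) < \<epsilon> / (cmod a)\<^sup>2"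
      using assms e unfolding closed_span_def by blast
    have eq: "(cmod (a * f x - (\<Sum>l\<in>F. (a * c l) * expo l x)))\<^sup>2 = (cmod a)\<^sup>2 * (cmod (f x - (\<Sum>l\<in>F. c l * expo l x)))\<^sup>2" for x
      unfolding power_mult_distrib [symmetric] norm_mult [symmetric]
      by (simp add: right_diff_distrib sum_distrib_left mult.assoc)
    have "(\<integral>x. (cmod (a * f x - (\<Sum>l\<in>F. (a * c l) * expo l x)))\<^sup>2 \<partial>M) < \<epsilon>"
      unfolding eq using F(3) False by (simp add: field_simps)
    then show "\<exists>F c. finite F \<and> F \<subseteq> \<Lambda> \<and> (\<integral>x. (cmod (a * f x - (\<Sum>l\<in>F. c l * expo l x)))\<^sup>2 \<partial>M) < \<epsilon>"
      using F(1,2) by (intro exI [of _ F] exI [of _ "\<lambda>l. a * c l"]) auto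
  qed
qed

lemma closed_span_sum:
  assumes "finite I" "\<And>i. i \<in> I \<Longrightarrow> closed_span \<Lambda> (f i)"
  shows "closed_span \<Lambda> (\<lambda>x. \<Sum>i\<in>I. f i x)"
  using assms by (induction I rule: finite_induct) (simp_all add: closed_span_0 closed_span_add)

text \<open>Dominated convergence turns pointwise limits into \<open>L^2\<close> limits; it drives
  the passage from continuous functions to indicators and on to all of \<open>L^2\<close>.\<close>

lemma closed_span_dominated:
  assumes s: "\<And>i. closed_span \<Lambda> (s i)" and f: "square_integrable M f"
    and lim: "\<And>x. (\<lambda>i. s i x) \<longlonglongrightarrow> f x"
    and w: "integrable M w" "\<And>i x. (cmod (f x - s i x))\<^sup>2 \<le> w x"
  shows "closed_span \<Lambda> f"
proof (rule closed_span_limit [OF f])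
  fix \<epsilon> :: real assume e: "\<epsilon> > 0"
  have [measurable]: "f \<in> borel_measurable M" "\<And>i. s i \<in> borel_measurable M"
    using f s by (auto simp: square_integrable_def closed_span_def)
  have "(\<lambda>i. \<integral>x. (cmod (f x - s i x))\<^sup>2 \<partial>M) \<longlonglongrightarrow> (\<integral>x. 0 \<partial>M)"
  proof (rule integral_dominated_convergence [where w = w])
    have "(\<lambda>i. (cmod (f x - s i x))\<^sup>2) \<longlonglongrightarrow> (cmod (f x - f x))\<^sup>2" for x
      by (intro tendsto_intros lim)
    then show "AE x in M. (\<lambda>i. (cmod (f x - s i x))\<^sup>2) \<longlonglongrightarrow> 0" by simp
  qed (use w in auto)
  then have "\<forall>\<^sub>F i in sequentially. (\<integral>x. (cmod (f x - s i x))\<^sup>2 \<partial>M) < \<epsilon>"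
    using e by (intro order_tendstoD(2)) auto
  then obtain i where "(\<integral>x. (cmod (f x - s i x))\<^sup>2 \<partial>M) < \<epsilon>"
    by (auto simp: eventually_sequentially)
  then show "\<exists>g. closed_span \<Lambda> g \<and> (\<integral>x. (cmod (f x - g x))\<^sup>2 \<partial>M) < \<epsilon>" using s by blast
qed

lemma closed_span_continuous:
  assumes supp: "AE x in M. x \<in> {-1..1}" and ex: "\<And>l. closed_span \<Lambda> (expo l)"
    and f: "continuous_on UNIV f" "\<And>x. \<bar>f x\<bar> \<le> B"
  shows "closed_span \<Lambda> (\<lambda>x. of_real (f x))"
proof (rule closed_span_limit)
  have [measurable]: "f \<in> borel_measurable borel" using f(1) by (rule borel_measurable_continuous_onI)
  show sf: "square_integrable M (\<lambda>x. of_real (f x))"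
    by (rule square_integrable_bounded [of _ B]) (use f(2) in auto)
  define R where "R = {g :: real \<Rightarrow> real. continuous_on UNIV g \<and> trig_poly (\<lambda>x. of_real (g x))}"
  interpret function_ring_on R "{-1..1 :: real}"
  proof
    show "(\<lambda>x. g x + h x) \<in> R" if "g \<in> R" "h \<in> R" for g h
      using that trig_poly.add by (auto simp: R_def intro!: continuous_intros)
    show "(\<lambda>x. g x * h x) \<in> R" if "g \<in> R" "h \<in> R" for g h
      using that trig_poly_mult by (auto simp: R_def intro!: continuous_intros)
    show "(\<lambda>x. c) \<in> R" for c by (auto simp: R_def trig_poly_const)
    fix x y :: real assume xy: "x \<in> {-1..1}" "y \<in> {-1..1}" "x \<noteq> y"
    \<comment> \<open>Frequency 1/8 sends \<open>{-1..1}\<close> into \<open>{-pi/4..pi/4}\<close>,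
      where the sine is injective, so one function separates all points.\<close>
    define u v where "u = 2 * pi * (1/8) * x" and "v = 2 * pi * (1/8) * y"
    have bd: "\<bar>2 * pi * (1/8) * z\<bar> \<le> pi / 2" if "z \<in> {-1..1}" for z
    proof -
      have "\<bar>2 * pi * (1/8) * z\<bar> = pi / 4 * \<bar>z\<bar>" by (simp add: abs_mult)
      also have "\<dots> \<le> pi / 4 * 1" using that by (intro mult_left_mono) auto
      finally show ?thesis using pi_gt_zero by simp
    qed
    have "sin u \<noteq> sin v"
    proof
      assume "sin u = sin v"
      moreover have "\<bar>u\<bar> \<le> pi / 2" "\<bar>v\<bar> \<le> pi / 2"
        using xy bd unfolding u_def v_def by blast+
      ultimately have "u = v" using sin_inj_pi [of u v] by (simp add: abs_le_iff)
      then show False using xy by (simp add: u_def v_def)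
    qed
    then have "sin (2 * pi * (1/8) * x) \<noteq> sin (2 * pi * (1/8) * y)"
      unfolding u_def v_def .
    moreover have "(\<lambda>x. sin (2 * pi * (1/8) * x)) \<in> R"
      unfolding R_def using trig_poly_sin [of "1/8"] by (auto intro!: continuous_intros)
    ultimately show "\<exists>g\<in>R. g x \<noteq> g y" by (rule bexI)
  qed (auto simp: R_def intro: continuous_on_subset)
  fix \<epsilon> :: real assume "\<epsilon> > 0"
  define e where "e = sqrt (\<epsilon> / 2)"
  have e: "e > 0" using \<open>\<epsilon> > 0\<close> by (simp add: e_def)
  obtain g where g: "g \<in> R" "\<forall>x\<in>{-1..1}. \<bar>f x - g x\<bar> < e"
    using Stone_Weierstrass_basic [OF continuous_on_subset [OF f(1)] e] by auto
  have "closed_span \<Lambda> (\<lambda>x. of_real (g x))"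
  proof -
    have "closed_span \<Lambda> h" if "trig_poly h" for h
      using that by induction (auto intro: closed_span_cmult closed_span_add ex)
    then show ?thesis using g(1) by (simp add: R_def)
  qed
  moreover have "(\<integral>x. (cmod (of_real (f x) - of_real (g x)))\<^sup>2 \<partial>M) < \<epsilon>"
  proof -
    have "(\<integral>x. (cmod (of_real (f x) - of_real (g x)))\<^sup>2 \<partial>M) \<le> (\<integral>x. e\<^sup>2 \<partial>M)"
    proof (rule integral_mono_AE)
      show "integrable M (\<lambda>x. (cmod (of_real (f x) - of_real (g x)))\<^sup>2)"
        using square_integrable_diff [OF sf, of "\<lambda>x. of_real (g x)"] \<open>closed_span \<Lambda> (\<lambda>x. of_real (g x))\<close>
        by (simp add: closed_span_def square_integrable_def)
      show "AE x in M. (cmod (of_real (f x) - of_real (g x)))\<^sup>2 \<le> e\<^sup>2"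
        using supp
      proof eventually_elim
        case (elim x)
        then have "\<bar>f x - g x\<bar> \<le> e" using g(2) by force
        then show ?case
          unfolding of_real_diff [symmetric] norm_of_real by (intro power_mono) auto
      qed
    qed auto
    also have "\<dots> < \<epsilon>" using \<open>\<epsilon> > 0\<close> by (simp add: e_def prob_space [unfolded space_eq_univ])
    finally show ?thesis .
  qed
  ultimately show "\<exists>g. closed_span \<Lambda> g \<and> (\<integral>x. (cmod (of_real (f x) - g x))\<^sup>2 \<partial>M) < \<epsilon>" by blast
qed

lemma closed_span_interval:
  assumes supp: "AE x in M. x \<in> {-1..1}" and ex: "\<And>l. closed_span \<Lambda> (expo l)"
  shows "closed_span \<Lambda> (indicator {a..b})"
proof (rule closed_span_dominated)
  \<comment> \<open>For \<open>a \<le> b\<close> this is the distance to \<open>{a..b}\<close>, and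
    \<open>g i\<close> is a trapezoid of slope \<open>i\<close>. For \<open>a > b\<close> it is
    positive everywhere, in agreement with the empty interval.\<close>
  define \<delta> where "\<delta> x = max 0 (a - x) + max 0 (x - b)" for x
  define g where "g i x = max 0 (1 - real i * \<delta> x)" for i x
  have bd: "0 \<le> g i x \<and> g i x \<le> 1" for i x by (auto simp: g_def \<delta>_def)
  show "closed_span \<Lambda> (\<lambda>x. of_real (g i x))" for i
  proof (rule closed_span_continuous [OF supp ex, where B = 1])
    show "continuous_on UNIV (g i)"
      unfolding g_def \<delta>_def by (intro continuous_intros)
  qed (use bd [of i] in auto)
  show "square_integrable M (indicator {a..b})"
    by (rule square_integrable_bounded [of _ 1]) (auto simp: indicator_def)
  show "(\<lambda>i. complex_of_real (g i x)) \<longlonglongrightarrow> indicator {a..b} x" for x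
  proof (cases "x \<in> {a..b}")
    case True
    then have "g i x = 1" for i by (simp add: g_def \<delta>_def)
    then show ?thesis using True by simp
  next
    case False
    then have d: "\<delta> x > 0" by (auto simp: \<delta>_def)
    obtain N where N: "1 / \<delta> x < real N" using reals_Archimedean2 by blast
    have "g i x = 0" if "i \<ge> N" for i
    proof -
      have "1 < real N * \<delta> x" using N d by (simp add: field_simps)
      also have "\<dots> \<le> real i * \<delta> x" using that d by (intro mult_right_mono) auto
      finally show ?thesis by (simp add: g_def)
    qed
    then have "\<forall>\<^sub>F i in sequentially. complex_of_real (g i x) = indicator {a..b} x"
      using False unfolding eventually_sequentially by (intro exI [of _ N]) auto
    then show ?thesis by (rule tendsto_eventually)
  qed
  show "(cmod (indicator {a..b} x - complex_of_real (g i x)))\<^sup>2 \<le> 1" for i x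
  proof -
    have "indicator {a..b} x - complex_of_real (g i x) = of_real (indicator {a..b} x - g i x)"
      by (auto simp: indicator_def)
    then have "(cmod (indicator {a..b} x - complex_of_real (g i x)))\<^sup>2 = (indicator {a..b} x - g i x)\<^sup>2"
      by (simp only: norm_of_real power2_abs)
    also have "\<dots> \<le> 1"
      using bd [of i x] by (auto simp: indicator_def abs_square_le_1)
    finally show ?thesis .
  qed
qed auto

lemma closed_span_indicator:
  assumes supp: "AE x in M. x \<in> {-1..1}" and ex: "\<And>l. closed_span \<Lambda> (expo l)"
    and A: "A \<in> sets borel"
  shows "closed_span \<Lambda> (indicator A)"
  using A
proof (induction rule: borel_set_induct)
  case empty
  then show ?case using closed_span_0 by (simp add: indicator_def)
next
  case (interval a b)
  then show ?case using closed_span_interval [OF supp ex] by blast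
next
  case (compl A)
  have "indicator (- A) = (\<lambda>x. expo 0 x + (- 1) * indicator A x :: complex)"
    by (auto simp: indicator_def)
  then show ?case using closed_span_add [OF ex closed_span_cmult [OF compl(2)], of 0 "- 1"] by simp
next
  case (union A)
  define s where "s n x = (\<Sum>i<n. indicator (A i) x :: complex)" for n x
  have s: "s n x = indicator (\<Union>i<n. A i) x" for n x
  proof (cases "\<exists>j<n. x \<in> A j")
    case False
    then show ?thesis by (simp add: s_def indicator_def)
  next
    case True
    then obtain j where j: "j < n" "x \<in> A j" by blast
    have "s n x = (\<Sum>i<n. if i = j then 1 else 0)"
      unfolding s_def
      by (rule sum.cong) (use j union(1) in \<open>auto simp: disjoint_family_on_def indicator_def\<close>)
    then show ?thesis using j by (auto simp: indicator_def)
  qed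
  show ?case
  proof (rule closed_span_dominated [where s = s and w = "\<lambda>_. 1"])
    show "closed_span \<Lambda> (s i)" for i
      unfolding s_def [abs_def] using union(3) by (intro closed_span_sum) auto
    show "square_integrable M (indicator (\<Union> (range A)))"
      by (rule square_integrable_bounded [of _ 1]) (use union(2) in \<open>auto simp: indicator_def\<close>)
    show "(\<lambda>i. s i x) \<longlonglongrightarrow> indicator (\<Union> (range A)) x" for x
    proof (cases "\<exists>j. x \<in> A j")
      case True
      then obtain j where "x \<in> A j" by blast
      then have "\<forall>\<^sub>F i in sequentially. s i x = indicator (\<Union> (range A)) x"
        unfolding eventually_sequentially s
        by (intro exI [of _ "Suc j"]) (auto simp: indicator_def Suc_le_eq)
      then show ?thesis by (rule tendsto_eventually)
    next
      case False
      then show ?thesis by (simp add: s indicator_def)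
    qed
    show "(cmod (indicator (\<Union> (range A)) x - s i x))\<^sup>2 \<le> 1" for i x
      unfolding s by (auto simp: indicator_def)
  qed auto
qed

text \<open>Totality is thereby reduced to approximating the exponentials of all real
  frequencies.\<close>

lemma total_exponentialsI:
  assumes supp: "AE x in M. x \<in> {-1..1}" and ex: "\<And>l. closed_span \<Lambda> (expo l)"
  shows "total_exponentials M \<Lambda>"
proof -
  have "closed_span \<Lambda> f" if f: "square_integrable M f" for f
  proof -
    have [measurable]: "f \<in> borel_measurable M" using f by (simp add: square_integrable_def)
    obtain s where s: "\<And>i. simple_function M (s i)" "\<And>x. (\<lambda>i. s i x) \<longlonglongrightarrow> f x"
      "\<And>i x. cmod (s i x) \<le> 2 * cmod (f x)"
      using borel_measurable_implies_sequence_metric [of f M 0] by auto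
    show ?thesis
    proof (rule closed_span_dominated [OF _ f s(2)])
      show "closed_span \<Lambda> (s i)" for i
      proof -
        have fin: "finite (range (s i))" using simple_functionD(1) [OF s(1)] by simp
        have "s i = (\<lambda>x. \<Sum>y\<in>range (s i). y * indicator (s i -` {y}) x)"
        proof
          fix x
          have "(\<Sum>y\<in>range (s i). y * indicator (s i -` {y}) x) = (\<Sum>y\<in>range (s i). if y = s i x then y else 0)"
            by (intro sum.cong) auto
          then show "s i x = (\<Sum>y\<in>range (s i). y * indicator (s i -` {y}) x)" using fin by simp
        qed
        moreover have "closed_span \<Lambda> (\<lambda>x. \<Sum>y\<in>range (s i). y * indicator (s i -` {y}) x)"
        proof (intro closed_span_sum fin closed_span_cmult closed_span_indicator supp ex)
          show "s i -` {y} \<in> sets borel" for y using simple_functionD(2) [OF s(1), of i "{y}"] by simp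
        qed
        ultimately show ?thesis by simp
      qed
      \<comment> \<open>From \<open>cmod (s i x) \<le> 2 * cmod (f x)\<close> the error is at most
        \<open>3 * cmod (f x)\<close>, hence the 9.\<close>
      show "integrable M (\<lambda>x. 9 * (cmod (f x))\<^sup>2)" using f by (simp add: square_integrable_def)
      show "(cmod (f x - s i x))\<^sup>2 \<le> 9 * (cmod (f x))\<^sup>2" for i x
      proof -
        have "cmod (f x - s i x) \<le> 3 * cmod (f x)"
          using norm_triangle_ineq4 [of "f x" "s i x"] s(3) [of i x] by simp
        then have "(cmod (f x - s i x))\<^sup>2 \<le> (3 * cmod (f x))\<^sup>2" by (intro power_mono) auto
        then show ?thesis by (simp add: power_mult_distrib)
      qed
    qed
  qed
  then show ?thesis by (auto simp: total_exponentials_def closed_span_def)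
qed

end


section \<open>The candidate spectrum\<close>

lemma sum_shift_power:
  "(\<Sum>k\<le>Suc n. (2 :: real) ^ (r * k) * c k) = c 0 + 2 ^ r * (\<Sum>k\<le>n. 2 ^ (r * k) * c (Suc k))"
  by (subst sum.atMost_Suc_shift) (simp add: sum_distrib_left power_add mult.assoc)

lemma zero_in_Lambda: "0 \<in> Lambda r"
  unfolding Lambda_def by (auto intro!: exI [of _ 0] exI [of _ "\<lambda>_. 0"])

lemma Lambda_digit_add:
  assumes "l \<in> Lambda r" "a \<in> {0, 1}"
  shows "a + 2 ^ r * l \<in> Lambda r"
proof -
  obtain n c where l: "l = (\<Sum>k\<le>n. 2 ^ (r * k) * c k)" and c: "\<forall>k\<le>n. c k \<in> {0, 1}"
    using assms(1) unfolding Lambda_def by blast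
  define d where "d k = (case k of 0 \<Rightarrow> a | Suc j \<Rightarrow> c j)" for k
  have "a + 2 ^ r * l = (\<Sum>k\<le>Suc n. 2 ^ (r * k) * d k)"
    unfolding sum_shift_power by (simp add: l d_def)
  moreover have "\<forall>k\<le>Suc n. d k \<in> {0, 1}"
    using c assms(2) by (auto simp: d_def split: nat.split)
  ultimately show ?thesis unfolding Lambda_def by blast
qed

text \<open>The induction adds digits at the low end, matching the self-similarity
  \<open>x / q\<close> of the Fourier transform.\<close>

lemma Lambda_induct [consumes 1, case_names zero digit]:
  assumes "l \<in> Lambda r" "P 0"
    and step: "\<And>l a. l \<in> Lambda r \<Longrightarrow> P l \<Longrightarrow> a \<in> {0, 1} \<Longrightarrow> P (a + 2 ^ r * l)"
  shows "P l"
proof -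
  have "P (\<Sum>k\<le>n. 2 ^ (r * k) * c k)" if "\<forall>k\<le>n. c k \<in> {0, 1}" for n c
    using that
  proof (induction n arbitrary: c)
    case 0
    then have "P (c 0 + 2 ^ r * 0)" using zero_in_Lambda assms(2) by (intro step) auto
    then show ?case by simp
  next
    case (Suc n)
    then have "P (\<Sum>k\<le>n. 2 ^ (r * k) * c (Suc k))" by (intro Suc.IH) auto
    moreover have "(\<Sum>k\<le>n. 2 ^ (r * k) * c (Suc k)) \<in> Lambda r"
      unfolding Lambda_def using Suc.prems by fastforce
    ultimately show ?case unfolding sum_shift_power using Suc.prems by (intro step) auto
  qed
  then show ?thesis using assms(1) unfolding Lambda_def by blast
qed

lemma Lambda_cases:
  assumes "l \<in> Lambda r"
  obtains a m where "a \<in> {0, 1}" "m \<in> Lambda r" "l = a + 2 ^ r * m"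
proof -
  have "\<exists>a m. a \<in> {0, 1} \<and> m \<in> Lambda r \<and> l = a + 2 ^ r * m"
    using assms
  proof (induction rule: Lambda_induct)
    case zero
    then show ?case using zero_in_Lambda by (intro exI [of _ 0]) auto
  qed blast
  then show thesis using that by blast
qed

lemma Lambda_eq: "Lambda r = (\<lambda>l. 2 ^ r * l) ` Lambda r \<union> (\<lambda>l. 1 + 2 ^ r * l) ` Lambda r"
proof (intro equalityI subsetI)
  fix l assume "l \<in> Lambda r"
  then show "l \<in> (\<lambda>l. 2 ^ r * l) ` Lambda r \<union> (\<lambda>l. 1 + 2 ^ r * l) ` Lambda r"
    by (rule Lambda_cases) auto
next
  fix l assume "l \<in> (\<lambda>l. 2 ^ r * l) ` Lambda r \<union> (\<lambda>l. 1 + 2 ^ r * l) ` Lambda r"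
  then show "l \<in> Lambda r"
    using Lambda_digit_add [of _ r 0] Lambda_digit_add [of _ r 1] by auto
qed

lemma Lambda_subset_Nats: "l \<in> Lambda r \<Longrightarrow> l \<in> \<nat>"
proof (induction rule: Lambda_induct)
  case (digit l a)
  have "real (2 ^ r) \<in> \<nat>" by (rule of_nat_in_Nats)
  then have "2 ^ r * l \<in> \<nat>" using digit.IH by (intro Nats_mult) simp_all
  then show ?case using digit.hyps(2) by (intro Nats_add) auto
qed simp

lemma countable_Lambda: "countable (Lambda r)"
proof (rule countable_subset)
  show "Lambda r \<subseteq> range real" using Lambda_subset_Nats by (auto simp: Nats_def)
qed simp

lemma even_ne_odd:
  assumes "r \<ge> 1" "x \<in> \<int>" "y \<in> \<int>"
  shows "2 ^ r * x \<noteq> 1 + 2 ^ r * (y :: real)"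
proof
  assume eq: "2 ^ r * x = 1 + 2 ^ r * y"
  obtain i j where "x = of_int i" "y = of_int j" using assms(2,3) by (auto elim!: Ints_cases)
  then have "real_of_int (2 ^ r * i) = real_of_int (1 + 2 ^ r * j)" using eq by simp
  then have "2 ^ r * i = 1 + 2 ^ r * j" by (simp only: of_int_eq_iff)
  then have "even (1 + 2 ^ r * j)" using assms(1) by (metis dvd_mult2 dvd_power zero_less_one less_le_trans)
  then show False using assms(1) by simp
qed

text \<open>\<open>k\<close> is the lowest position at which the digits differ: there the difference
  is 1 or -1 plus a multiple of the even number \<open>2 ^ r\<close>. These are exactly the zeros
  provided by \<open>ft_zero\<close>.\<close>

lemma Lambda_diff:
  assumes r: "r \<ge> 1" and "l \<in> Lambda r" "m \<in> Lambda r" "l \<noteq> m"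
  shows "\<exists>k j. odd j \<and> l - m = 2 ^ (r * k) * real_of_int j"
  using assms(2-)
proof (induction arbitrary: m rule: Lambda_induct)
  case zero
  show ?case using zero
  proof (induction rule: Lambda_induct)
    case (digit l a)
    show ?case
    proof (cases "a = 0")
      case True
      then obtain k j where kj: "odd j" "0 - l = 2 ^ (r * k) * real_of_int j" using digit by auto
      have "0 - (a + 2 ^ r * l) = 2 ^ r * (0 - l)" using True by simp
      also have "\<dots> = 2 ^ (r * Suc k) * real_of_int j" unfolding kj by (simp add: power_add)
      finally show ?thesis using kj(1) by blast
    next
      case False
      obtain i where i: "l = real i" using Lambda_subset_Nats [OF digit.hyps(1)] by (auto simp: Nats_def)
      have "odd (- 1 - 2 ^ r * int i)" using r by simp
      moreover have "0 - (a + 2 ^ r * l) = 2 ^ (r * 0) * real_of_int (- 1 - 2 ^ r * int i)"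
        using False digit i by auto
      ultimately show ?thesis by blast
    qed
  qed simp
next
  case (digit l a)
  obtain b m' where m: "b \<in> {0, 1}" "m' \<in> Lambda r" "m = b + 2 ^ r * m'"
    using digit.prems(1) by (rule Lambda_cases)
  show ?case
  proof (cases "a = b")
    case True
    then obtain k j where kj: "odd j" "l - m' = 2 ^ (r * k) * real_of_int j"
      using digit.IH [OF m(2)] digit.prems(2) m(3) by blast
    have "a + 2 ^ r * l - m = 2 ^ r * (l - m')" using True m by (simp add: algebra_simps)
    also have "\<dots> = 2 ^ (r * Suc k) * real_of_int j" unfolding kj by (simp add: power_add)
    finally show ?thesis using kj(1) by blast
  next
    case False
    obtain i i' where i: "l = real i" "m' = real i'"
      using Lambda_subset_Nats [OF digit.hyps(1)] Lambda_subset_Nats [OF m(2)] by (auto simp: Nats_def)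
    define j where "j = (if a = 0 then -1 else 1) + 2 ^ r * (int i - int i')"
    have "odd j" using r by (simp add: j_def)
    moreover have "a + 2 ^ r * l - m = 2 ^ (r * 0) * real_of_int j"
      using False digit.hyps(2) m by (auto simp: j_def i algebra_simps)
    ultimately show ?thesis by blast
  qed
qed

lemma norm_half_expo: "(cmod ((1 + expo (1/2) x) / 2))\<^sup>2 = (cos (pi * x / 2))\<^sup>2"
proof -
  have "(cmod ((1 + expo (1/2) x) / 2))\<^sup>2 = ((1 + cos (pi * x)) / 2)\<^sup>2 + (sin (pi * x) / 2)\<^sup>2"
    unfolding cmod_power2 by (simp add: expo_eq_cis)
  also have "\<dots> = (1 + 2 * cos (pi * x) + ((sin (pi * x))\<^sup>2 + (cos (pi * x))\<^sup>2)) / 4"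
    unfolding power_divide power2_sum by (simp add: field_simps)
  also have "\<dots> = (1 + cos (pi * x)) / 2" by simp
  also have "cos (pi * x) = cos (2 * (pi * x / 2))" by simp
  also have "(1 + cos (2 * (pi * x / 2))) / 2 = (cos (pi * x / 2))\<^sup>2"
    unfolding cos_double_cos by simp
  finally show ?thesis .
qed

section \<open>The Fourier transform of the Cantor measure\<close>

locale cantor_distribution =
  fixes r :: nat and M :: "real measure"
  assumes inv: "invariant_measure r M" and r: "2 \<le> r"
begin

sublocale real_distribution M
  by (rule real_distribution_invariant [OF inv])

abbreviation q :: real where "q \<equiv> 2 ^ r"

lemma q_ge: "4 \<le> q"
  using power_increasing [of 2 r "2 :: real"] r by simp

text \<open>Both maps contract by \<open>q \<ge> 4\<close> and shift by at most 1/2, so a point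
  mapped outside \<open>{-L..L}\<close> was already outside the doubled interval.\<close>

lemma phi_outside:
  assumes "1 \<le> L"
  shows "phi0 r -` (- {-L..L}) \<subseteq> - {-(2 * L)..2 * L}" "phi1 r -` (- {-L..L}) \<subseteq> - {-(2 * L)..2 * L}"
proof -
  have h: "(2 :: real) ^ r = 2 * 2 ^ (r - 1)" using r by (cases r) auto
  have h2: "(2 :: real) \<le> 2 ^ (r - 1)" using power_increasing [of 1 "r - 1" "2 :: real"] r by simp
  define s where "s = (2 :: real) ^ (r - 1)"
  have s2: "2 \<le> s" "q = 2 * s" using h h2 by (auto simp: s_def)
  have eq: "- L * (2 * s) = - (2 * (s * L))" "L * (2 * s) = 2 * (s * L)" by simp_all
  have s1: "2 ^ (r - 1) = s" by (simp add: s_def)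
  have sL: "s * 1 \<le> s * L" "2 * L \<le> s * L" using s2 assms by (auto intro!: mult_left_mono mult_right_mono)
  show "phi0 r -` (- {-L..L}) \<subseteq> - {-(2 * L)..2 * L}"
  proof
    fix x assume "x \<in> phi0 r -` (- {-L..L})"
    then have "x / (2 * s) < - L \<or> L < x / (2 * s)" by (auto simp: phi0_def s2)
    then have "x < - L * (2 * s) \<or> L * (2 * s) < x" using s2 by (auto simp: field_simps)
    then have "x < - (2 * L) \<or> 2 * L < x"
      using sL s2 assms unfolding eq by linarith
    then show "x \<in> - {-(2 * L)..2 * L}" by auto
  qed
  show "phi1 r -` (- {-L..L}) \<subseteq> - {-(2 * L)..2 * L}"
  proof
    fix x assume "x \<in> phi1 r -` (- {-L..L})"
    then have "(x + s) / (2 * s) < - L \<or> L < (x + s) / (2 * s)" unfolding phi1_def s1 s2 by auto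
    then have "x + s < - L * (2 * s) \<or> L * (2 * s) < x + s" using s2 by (auto simp: field_simps)
    then have "x < - (2 * L) \<or> 2 * L < x"
      using sL s2 assms unfolding eq by linarith
    then show "x \<in> - {-(2 * L)..2 * L}" by auto
  qed
qed

text \<open>By invariance the mass outside \<open>{-(2 ^ k)..2 ^ k}\<close> does not decrease with
  \<open>k\<close>, yet it tends to 0; so it is 0 from the start.\<close>

lemma measure_outside: "measure M (- {-1..1}) = 0"
proof -
  define f where "f k = measure M (- {-(2 ^ k)..2 ^ k})" for k :: nat
  have step: "f k \<le> f (Suc k)" for k
  proof -
    have 1: "measure M (phi0 r -` (- {-(2 ^ k)..2 ^ k})) \<le> f (Suc k)"
      "measure M (phi1 r -` (- {-(2 ^ k)..2 ^ k})) \<le> f (Suc k)"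
      unfolding f_def using phi_outside [of "2 ^ k"] by (auto intro!: finite_measure_mono)
    have "f k = 1/2 * measure M (phi0 r -` (- {-(2 ^ k)..2 ^ k})) + 1/2 * measure M (phi1 r -` (- {-(2 ^ k)..2 ^ k}))"
      using inv unfolding f_def invariant_measure_def by simp
    then show ?thesis using 1 by simp
  qed
  have inc: "f 0 \<le> f k" for k
    using lift_Suc_mono_le [of f, OF step] by simp
  have "f \<longlonglongrightarrow> measure M (\<Inter>k. - {-(2 ^ k)..2 ^ k})"
    unfolding f_def
  proof (rule finite_Lim_measure_decseq)
    show "decseq (\<lambda>k. - {-(2 ^ k)..2 ^ k :: real})"
    proof (rule decseq_SucI)
      show "- {-(2 ^ Suc k)..2 ^ Suc k} \<subseteq> - {-(2 ^ k)..2 ^ k :: real}" for k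
        using zero_le_power [of "2 :: real" k] by auto
    qed
  qed auto
  moreover have "(\<Inter>k. - {-(2 ^ k)..2 ^ k}) = ({} :: real set)"
  proof -
    have "\<exists>k. x \<in> {-(2 ^ k)..2 ^ k}" for x :: real
    proof -
      obtain k where "\<bar>x\<bar> < 2 ^ k" using real_arch_pow [of 2 "\<bar>x\<bar>"] by auto
      then show ?thesis by (intro exI [of _ k]) auto
    qed
    then show ?thesis by blast
  qed
  ultimately have "f \<longlonglongrightarrow> 0" by simp
  then have "f 0 \<le> 0" by (rule LIMSEQ_le_const) (use inc in auto)
  then show ?thesis by (simp add: f_def measure_le_0_iff)
qed

lemma AE_support: "AE x in M. x \<in> {-1..1}"
proof -
  have "emeasure M (- {-1..1}) = 0" using measure_outside by (simp add: emeasure_eq_measure)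
  then show ?thesis by (intro AE_I [of _ _ "- {-1..1}"]) auto
qed

lemma compactly_supported: "compactly_supported M"
  unfolding compactly_supported_def
  using measure_outside by (intro exI [of _ "{-1..1}"]) (auto simp: emeasure_eq_measure)

definition ft :: "real \<Rightarrow> complex" where
  "ft x = (\<integral>y. expo x y \<partial>M)"

lemma integrable_expo [simp]: "integrable M (expo l)"
  by (rule integrable_const_bound [of _ 1]) auto

lemma ft_eq_char: "ft x = char M (- 2 * pi * x)"
proof -
  have "expo x = (\<lambda>y. iexp (- 2 * pi * x * y))"
    unfolding expo_eq_cis cis_conv_exp by (rule ext) simp
  then show ?thesis unfolding ft_def char_def by (simp only:)
qed

lemma ft_0: "ft 0 = 1"
  by (simp add: ft_eq_char char_zero)

lemma continuous_ft: "isCont ft x"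
proof -
  have "isCont (\<lambda>x. char M (- 2 * pi * x)) x"
    by (rule isCont_o2 [OF _ isCont_char]) (intro continuous_intros)
  then show ?thesis by (simp add: ft_eq_char [abs_def])
qed

lemma ft_step: "ft x = (1 + expo (1/2) x) / 2 * ft (x / q)"
proof -
  have "2 ^ (r - 1) / q = (1/2 :: real)" using r by (cases r) auto
  then have "- 2 * pi * x * 2 ^ (r - 1) / q = - 2 * pi * (1/2) * x"
    by (metis mult.assoc mult.commute times_divide_eq_right)
  then have "iexp (- 2 * pi * x * 2 ^ (r - 1) / q) = expo (1/2) x"
    unfolding expo_eq_cis cis_conv_exp by (simp only:)
  moreover have "- 2 * pi * x / q = - 2 * pi * (x / q)" by simp
  ultimately show ?thesis
    unfolding ft_eq_char by (subst char_invariant [OF inv]) (simp only:)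
qed

lemma norm_ft_step: "(cmod (ft x))\<^sup>2 = (cos (pi * x / 2))\<^sup>2 * (cmod (ft (x / q)))\<^sup>2"
  by (subst ft_step) (simp only: norm_mult power_mult_distrib norm_half_expo)

text \<open>The cosine factor vanishes at odd integers, and \<open>ft_step\<close> carries a zero at
  \<open>x / q\<close> to \<open>x\<close>.\<close>

lemma ft_zero:
  assumes "odd j"
  shows "ft (2 ^ (r * k) * real_of_int j) = 0"
proof (induction k)
  case 0
  obtain i where "j = 2 * i + 1" using assms by (elim oddE)
  then have "pi * real_of_int j / 2 = pi * real_of_int i + pi / 2" by (simp add: field_simps)
  moreover have "cos (pi * real_of_int i + pi / 2) = 0" by (simp add: cos_add)
  ultimately have "cos (pi * real_of_int j / 2) = 0" by (simp only:)
  then have "(cmod (ft (real_of_int j)))\<^sup>2 = 0" by (subst norm_ft_step) simp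
  then show ?case by simp
next
  case (Suc k)
  have "2 ^ (r * Suc k) * real_of_int j / q = 2 ^ (r * k) * real_of_int j"
    by (simp add: power_add)
  then show ?case using Suc by (subst ft_step) simp
qed


lemma odd_times_Lambda_diff:
  assumes "odd t" "l \<in> Lambda r" "m \<in> Lambda r" "l \<noteq> m"
  shows "ft (real_of_int t * l - real_of_int t * m) = 0"
proof -
  obtain k j where kj: "odd j" "l - m = 2 ^ (r * k) * real_of_int j"
    using Lambda_diff [of r l m] assms r by auto
  have "real_of_int t * l - real_of_int t * m = real_of_int t * (l - m)" by (simp add: algebra_simps)
  also have "\<dots> = 2 ^ (r * k) * real_of_int (t * j)" unfolding kj by simp
  finally show ?thesis using ft_zero [of "t * j" k] assms(1) kj(1) by simp
qed

lemma integral_expo_mult_cnj: "(\<integral>x. expo l x * cnj (expo m x) \<partial>M) = ft (l - m)"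
  by (simp add: expo_mult_cnj ft_def)

lemma orthonormal_odd_times_Lambda:
  assumes "odd t"
  shows "orthonormal_exponentials M ((*) (real_of_int t) ` Lambda r)"
  unfolding orthonormal_exponentials_def integral_expo_mult_cnj
  using odd_times_Lambda_diff [OF assms] by (auto simp: ft_0)

text \<open>The number \<open>ft (x - l)\<close> is the Fourier coefficient of \<open>expo x\<close>
  along \<open>expo l\<close>, so this is the Pythagorean identity for the projection onto a finite
  orthonormal family.\<close>

lemma integral_norm_diff_square:
  assumes F: "finite F" and orth: "\<And>l m. l \<in> F \<Longrightarrow> m \<in> F \<Longrightarrow> ft (l - m) = (if l = m then 1 else 0)"
  shows "(\<integral>y. (cmod (expo x y - (\<Sum>l\<in>F. ft (x - l) * expo l y)))\<^sup>2 \<partial>M) = 1 - (\<Sum>l\<in>F. (cmod (ft (x - l)))\<^sup>2)"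
proof -
  define c where "c l = ft (x - l)" for l
  define g where "g y = (\<Sum>l\<in>F. c l * expo l y)" for y
  have cnj_c: "cnj (c l) = ft (l - x)" for l
    unfolding c_def ft_def using Bochner_Integration.integral_cnj [of M "expo (x - l)"] by (simp add: cnj_expo)
  have expand: "complex_of_real ((cmod (expo x y - g y))\<^sup>2) =
      1 - (\<Sum>l\<in>F. cnj (c l) * expo (x - l) y) - (\<Sum>l\<in>F. c l * expo (l - x) y)
        + (\<Sum>l\<in>F. \<Sum>m\<in>F. c l * cnj (c m) * expo (l - m) y)" for y
  proof -
    have "complex_of_real ((cmod (expo x y - g y))\<^sup>2) = (expo x y - g y) * cnj (expo x y - g y)"
      by (rule complex_norm_square)
    also have "\<dots> = expo x y * cnj (expo x y) - expo x y * cnj (g y) - g y * cnj (expo x y) + g y * cnj (g y)"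
      by (simp add: algebra_simps)
    also have "expo x y * cnj (expo x y) = 1" by (simp add: expo_mult_cnj)
    also have "expo x y * cnj (g y) = (\<Sum>l\<in>F. cnj (c l) * (expo x y * cnj (expo l y)))"
      by (simp add: g_def cnj_sum sum_distrib_left mult_ac)
    also have "g y * cnj (expo x y) = (\<Sum>l\<in>F. c l * (expo l y * cnj (expo x y)))"
      by (simp add: g_def sum_distrib_left mult_ac)
    also have "g y * cnj (g y) = (\<Sum>l\<in>F. \<Sum>m\<in>F. c l * cnj (c m) * (expo l y * cnj (expo m y)))"
      by (simp add: g_def cnj_sum sum_product mult_ac)
    finally show ?thesis by (simp only: expo_mult_cnj)
  qed
  have "complex_of_real (\<integral>y. (cmod (expo x y - g y))\<^sup>2 \<partial>M) = (\<integral>y. complex_of_real ((cmod (expo x y - g y))\<^sup>2) \<partial>M)"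
  proof (rule integral_of_real [symmetric])
    have "square_integrable M (\<lambda>y. expo x y - g y)"
      unfolding g_def by (intro square_integrable_diff square_integrable_expo_sum square_integrable_bounded [of _ 1]) auto
    then show "integrable M (\<lambda>y. (cmod (expo x y - g y))\<^sup>2)" by (simp add: square_integrable_def)
  qed
  also have "\<dots> = 1 - (\<Sum>l\<in>F. cnj (c l) * ft (x - l)) - (\<Sum>l\<in>F. c l * ft (l - x))
        + (\<Sum>l\<in>F. \<Sum>m\<in>F. c l * cnj (c m) * ft (l - m))"
    unfolding expand ft_def
    by (simp add: prob_space [unfolded space_eq_univ])
  also have "(\<Sum>l\<in>F. \<Sum>m\<in>F. c l * cnj (c m) * ft (l - m)) = (\<Sum>l\<in>F. \<Sum>m\<in>F. if l = m then c l * cnj (c m) else 0)"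
    using orth by (intro sum.cong) auto
  also have "\<dots> = (\<Sum>l\<in>F. c l * cnj (c l))" using F by simp
  also have "(\<Sum>l\<in>F. c l * ft (l - x)) = (\<Sum>l\<in>F. c l * cnj (c l))" by (simp add: cnj_c)
  also have "(\<Sum>l\<in>F. cnj (c l) * ft (x - l)) = (\<Sum>l\<in>F. c l * cnj (c l))"
    by (simp add: c_def [symmetric] mult.commute)
  also have "(\<Sum>l\<in>F. c l * cnj (c l)) = complex_of_real (\<Sum>l\<in>F. (cmod (c l))\<^sup>2)"
    by (simp add: complex_norm_square del: of_real_power)
  finally have "complex_of_real (\<integral>y. (cmod (expo x y - g y))\<^sup>2 \<partial>M) = complex_of_real (1 - (\<Sum>l\<in>F. (cmod (c l))\<^sup>2))"
    by simp
  then show ?thesis unfolding of_real_eq_iff g_def c_def .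
qed

end

section \<open>Spectral pairs without integer cycles\<close>

text \<open>This isolates what the analysis requires of the dilation factor; it is instantiated with
  1 and with \<open>p ^ n\<close>.\<close>

locale cantor_odd_dilation = cantor_distribution +
  fixes t :: int
  assumes t: "odd t" "0 < t" and no_trap: "\<not> integer_trap r t C"
begin

text \<open>The Bessel sum of \<open>expo (- x)\<close>, that is, its squared projection norm onto
  the closed span of the family; completeness amounts to the value 1.\<close>

definition Q :: "real \<Rightarrow> real" where
  "Q x = (\<Sum>\<^sub>\<infinity>l\<in>Lambda r. (cmod (ft (x + t * l)))\<^sup>2)"

lemma bessel_expo:
  assumes "finite F" "F \<subseteq> Lambda r"
  shows "(\<Sum>l\<in>F. (cmod (ft (x + t * l)))\<^sup>2) = 
    1 - (\<integral>y. (cmod (expo (- x) y - (\<Sum>l\<in>(*) (real_of_int t) ` F. ft (- x - l) * expo l y)))\<^sup>2 \<partial>M)"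
proof -
  have inj: "inj_on ((*) (real_of_int t)) F" using t by (auto simp: inj_on_def)
  have "cmod (ft (- z)) = cmod (ft z)" for z
  proof -
    have "ft (- z) = cnj (ft z)"
      unfolding ft_def using Bochner_Integration.integral_cnj [of M "expo z"] by (simp add: cnj_expo)
    then show ?thesis by simp
  qed
  from this [of "x + t * l" for l :: real]
  have "(\<Sum>l\<in>F. (cmod (ft (x + t * l)))\<^sup>2) = (\<Sum>l\<in>(*) (real_of_int t) ` F. (cmod (ft (- x - l)))\<^sup>2)"
    using inj by (simp add: sum.reindex)
  also have "\<dots> = 1 - (\<integral>y. (cmod (expo (- x) y - (\<Sum>l\<in>(*) (real_of_int t) ` F. ft (- x - l) * expo l y)))\<^sup>2 \<partial>M)"
    by (subst integral_norm_diff_square)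
      (use assms odd_times_Lambda_diff [OF t(1)] in \<open>auto simp: ft_0 subset_iff\<close>)
  finally show ?thesis .
qed

lemma partial_sum_le_1:
  assumes "finite F" "F \<subseteq> Lambda r"
  shows "(\<Sum>l\<in>F. (cmod (ft (x + t * l)))\<^sup>2) \<le> 1"
  unfolding bessel_expo [OF assms] by simp

lemma summable_Q: "(\<lambda>l. (cmod (ft (x + t * l)))\<^sup>2) summable_on Lambda r"
  by (rule nonneg_bdd_above_summable_on)
    (auto intro!: bdd_aboveI [of _ 1] partial_sum_le_1)

lemma partial_sum_le_Q:
  assumes "finite F" "F \<subseteq> Lambda r"
  shows "(\<Sum>l\<in>F. (cmod (ft (x + t * l)))\<^sup>2) \<le> Q x"
  unfolding Q_def by (rule finite_sum_le_infsum [OF summable_Q assms]) simp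

lemma Q_le:
  assumes "\<And>F. finite F \<Longrightarrow> F \<subseteq> Lambda r \<Longrightarrow> (\<Sum>l\<in>F. (cmod (ft (x + t * l)))\<^sup>2) \<le> b"
  shows "Q x \<le> b"
  unfolding Q_def by (rule infsum_le_finite_sums [OF summable_Q assms])

lemma Q_nonneg: "0 \<le> Q x"
  using partial_sum_le_Q [of "{}"] by simp

lemma Q_0: "1 \<le> Q 0"
  using partial_sum_le_Q [of "{0}" 0] zero_in_Lambda by (simp add: ft_0)

text \<open>\<open>Q\<close> is a supremum of continuous finite sums, hence lower semicontinuous.
  The varying bound \<open>b n\<close> accommodates a minimising sequence.\<close>

lemma Q_limit_le:
  assumes "X \<longlonglongrightarrow> x" "\<And>n :: nat. Q (X n) \<le> b n" "b \<longlonglongrightarrow> c"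
  shows "Q x \<le> c"
proof (rule Q_le)
  fix F assume F: "finite F" "F \<subseteq> Lambda r"
  have "isCont (\<lambda>x. \<Sum>l\<in>F. (cmod (ft (x + t * l)))\<^sup>2) x"
    by (intro continuous_intros isCont_o2 [OF _ continuous_ft])
  then have "(\<lambda>n. \<Sum>l\<in>F. (cmod (ft (X n + t * l)))\<^sup>2) \<longlonglongrightarrow> (\<Sum>l\<in>F. (cmod (ft (x + t * l)))\<^sup>2)"
    using assms(1) by (rule isCont_tendsto_compose)
  then show "(\<Sum>l\<in>F. (cmod (ft (x + t * l)))\<^sup>2) \<le> c"
    by (rule LIMSEQ_le [OF _ assms(3)])
      (use partial_sum_le_Q [OF F] assms(2) order_trans in blast)
qed

lemma cos_square_shift:
  assumes "j \<in> \<int>"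
  shows "(cos (pi * (x + 2 * j) / 2))\<^sup>2 = (cos (pi * x / 2))\<^sup>2"
proof -
  obtain i where i: "j = of_int i" using assms by (elim Ints_cases)
  have e: "pi * (x + 2 * j) / 2 = pi * x / 2 + pi * of_int i" by (simp add: i field_simps)
  have c: "cos (pi * (x + 2 * j) / 2) = cos (pi * x / 2) * cos (pi * of_int i)"
    unfolding e cos_add by (simp only: sin_npi_int mult_zero_right diff_zero)
  have "(cos (pi * of_int i))\<^sup>2 = (1 :: real)"
    using sin_cos_squared_add [of "pi * of_int i"] by simp
  then show ?thesis
    unfolding c power_mult_distrib by (simp only: mult_1_right)
qed

text \<open>As \<open>q\<close> is even, \<open>t * (q * l)\<close> is an even integer, so it leaves
  the squared cosine in \<open>norm_ft_step\<close> unchanged.\<close>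

lemma ft_even_branch:
  fixes x l :: real
  assumes "l \<in> Lambda r"
  shows "(cmod (ft (x + t * (q * l))))\<^sup>2 = (cos (pi * x / 2))\<^sup>2 * (cmod (ft (x / q + t * l)))\<^sup>2"
proof -
  have h: "q = 2 * 2 ^ (r - 1)" using r by (cases r) auto
  have e: "x + t * (q * l) = x + 2 * (t * (2 ^ (r - 1) * l))" unfolding h by (simp add: algebra_simps)
  have "real_of_int t * (2 ^ (r - 1) * l) \<in> \<int>"
    using Lambda_subset_Nats [OF assms] Nats_subset_Ints by (intro Ints_mult Ints_power) auto
  then have c: "(cos (pi * (x + t * (q * l)) / 2))\<^sup>2 = (cos (pi * x / 2))\<^sup>2"
    unfolding e by (rule cos_square_shift)
  have d: "(x + t * (q * l)) / q = x / q + t * l" by (simp add: field_simps)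
  show ?thesis by (subst norm_ft_step) (simp only: c d)
qed

text \<open>The lowest digit 1 shifts the argument by the odd number \<open>t\<close>, which turns
  the squared cosine into a squared sine.\<close>

lemma ft_odd_branch:
  fixes x l :: real
  assumes "l \<in> Lambda r"
  shows "(cmod (ft (x + t * (1 + q * l))))\<^sup>2 = (sin (pi * x / 2))\<^sup>2 * (cmod (ft ((x + t) / q + t * l)))\<^sup>2"
proof -
  obtain i where i: "t = 2 * i + 1" using t(1) by (elim oddE)
  have e: "pi * (x + t) / 2 = pi * x / 2 + (pi * of_int i + pi / 2)"
    by (simp add: i field_simps)
  have c0: "cos (pi * of_int i + pi / 2) = 0" by (simp add: cos_add)
  then have s1: "(sin (pi * of_int i + pi / 2))\<^sup>2 = 1"
    using sin_cos_squared_add [of "pi * of_int i + pi / 2"] by simp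
  have "cos (pi * (x + t) / 2) = - (sin (pi * x / 2) * sin (pi * of_int i + pi / 2))"
    unfolding e cos_add [of "pi * x / 2"] c0 by simp
  then have s: "(cos (pi * (x + t) / 2))\<^sup>2 = (sin (pi * x / 2))\<^sup>2"
    by (simp only: power2_minus power_mult_distrib s1 mult_1_right)
  have "x + t * (1 + q * l) = (x + t) + t * (q * l)" by (simp add: algebra_simps)
  then show ?thesis using ft_even_branch [OF assms, of "x + t"] by (simp only: s)
qed

text \<open>Split \<open>Lambda r\<close> by its lowest digit. The weights add up to 1, so
  \<open>Q x\<close> is a weighted mean of two values of \<open>Q\<close>.\<close>

lemma Q_refinement:
  "Q x = (cos (pi * x / 2))\<^sup>2 * Q (x / q) + (sin (pi * x / 2))\<^sup>2 * Q ((x + t) / q)"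
proof -
  define f where "f l = (cmod (ft (x + t * l)))\<^sup>2" for l :: real
  have disj: "(\<lambda>l. q * l) ` Lambda r \<inter> (\<lambda>l. 1 + q * l) ` Lambda r = {}"
  proof -
    have "q * l \<noteq> 1 + q * m" if "l \<in> Lambda r" "m \<in> Lambda r" for l m
      using that r Lambda_subset_Nats Nats_subset_Ints by (intro even_ne_odd) auto
    then show ?thesis by blast
  qed
  have inj: "inj_on (\<lambda>l. q * l) (Lambda r)" "inj_on (\<lambda>l. 1 + q * l) (Lambda r)"
    by (auto simp: inj_on_def)
  have sub: "(\<lambda>l. q * l) ` Lambda r \<subseteq> Lambda r" "(\<lambda>l. 1 + q * l) ` Lambda r \<subseteq> Lambda r"
    using Lambda_eq [of r] by blast+
  have summ: "f summable_on Lambda r" unfolding f_def by (rule summable_Q)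
  have "Q x = infsum f ((\<lambda>l. q * l) ` Lambda r \<union> (\<lambda>l. 1 + q * l) ` Lambda r)"
    unfolding Q_def f_def by (subst Lambda_eq) (rule refl)
  also have "\<dots> = infsum f ((\<lambda>l. q * l) ` Lambda r) + infsum f ((\<lambda>l. 1 + q * l) ` Lambda r)"
    by (intro infsum_Un_disjoint summable_on_subset_banach [OF summ] sub disj)
  also have "infsum f ((\<lambda>l. q * l) ` Lambda r) = (\<Sum>\<^sub>\<infinity>l\<in>Lambda r. f (q * l))"
    by (simp add: infsum_reindex [OF inj(1)] o_def)
  also have "\<dots> = (\<Sum>\<^sub>\<infinity>l\<in>Lambda r. (cos (pi * x / 2))\<^sup>2 * (cmod (ft (x / q + t * l)))\<^sup>2)"
    unfolding f_def by (intro infsum_cong ft_even_branch)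
  also have "\<dots> = (cos (pi * x / 2))\<^sup>2 * Q (x / q)"
    unfolding Q_def by (rule infsum_cmult_right')
  also have "infsum f ((\<lambda>l. 1 + q * l) ` Lambda r) = (\<Sum>\<^sub>\<infinity>l\<in>Lambda r. f (1 + q * l))"
    by (simp add: infsum_reindex [OF inj(2)] o_def)
  also have "\<dots> = (\<Sum>\<^sub>\<infinity>l\<in>Lambda r. (sin (pi * x / 2))\<^sup>2 * (cmod (ft ((x + t) / q + t * l)))\<^sup>2)"
    unfolding f_def by (intro infsum_cong ft_odd_branch)
  also have "\<dots> = (sin (pi * x / 2))\<^sup>2 * Q ((x + t) / q)"
    unfolding Q_def by (rule infsum_cmult_right')
  finally show ?thesis .
qed

text \<open>
  \<open>Q\<close> is lower semicontinuous and attains its minimum on \<open>[-A, A]\<close>. By the refinement equation the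
  set \<open>Z\<close> of minimisers is closed under every branch of positive weight. A non-integer point of
  \<open>Z\<close> would drag the limit \<open>0\<close> of \<open>x / q\<^sup>k\<close> into \<open>Z\<close>, and on the integers exactly one branch has
  positive weight, so that \<open>Z\<close> is an integer trap.
\<close>
lemma Q_ge_1: "1 \<le> Q x"
proof (rule ccontr)
  assume less: "\<not> 1 \<le> Q x"
  \<comment> \<open>\<open>A \<ge> \<bar>x\<bar>\<close> puts \<open>x\<close> into the interval,
    and \<open>A \<ge> t\<close> makes both branches map the interval into itself.\<close>
  define A where "A = max \<bar>x\<bar> t"
  have A: "\<bar>x\<bar> \<le> A" "t \<le> A" by (auto simp: A_def)
  define b where "b = Inf (Q ` {-A..A})"
  have bdd: "bdd_below (Q ` {-A..A})" by (rule bdd_belowI [of _ 0]) (use Q_nonneg in auto)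
  have b_le: "b \<le> Q y" if "y \<in> {-A..A}" for y
    unfolding b_def by (rule cInf_lower) (use bdd that in auto)
  have "x \<in> {-A..A}" using A by auto
  then have b1: "b < 1" using b_le less by force
  define Z where "Z = {y \<in> {-A..A}. Q y \<le> b}"
  have closed: "y \<in> Z" if "Y \<longlonglongrightarrow> y" "\<And>n. Y n \<in> Z" for Y :: "nat \<Rightarrow> real" and y
  proof -
    have "Q y \<le> b" by (rule Q_limit_le [OF that(1) _ tendsto_const]) (use that(2) in \<open>auto simp: Z_def\<close>)
    moreover have "y \<in> {-A..A}"
      by (rule closed_sequentially [OF closed_atLeastAtMost _ that(1)]) (use that(2) in \<open>auto simp: Z_def\<close>)
    ultimately show ?thesis by (simp add: Z_def)
  qed
  have "0 \<notin> Z" using Q_0 b1 by (auto simp: Z_def)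
  have "Z \<noteq> {}"
  proof -
    have "\<exists>y\<in>{-A..A}. Q y < b + 1 / real (Suc n)" for n
      using cInf_lessD [of "Q ` {-A..A}" "b + 1 / real (Suc n)"] \<open>x \<in> {-A..A}\<close>
      unfolding b_def by auto
    then obtain Y where Y: "\<And>n. Y n \<in> {-A..A}" "\<And>n. Q (Y n) < b + 1 / real (Suc n)" by metis
    obtain y k where y: "y \<in> {-A..A}" and k: "strict_mono (k :: nat \<Rightarrow> nat)" and lim: "(Y \<circ> k) \<longlonglongrightarrow> y"
      using compact_Icc [of "-A" A] Y(1) unfolding compact_def by blast
    have "(\<lambda>n. b + 1 / real (Suc n)) \<longlonglongrightarrow> b + 0"
      by (intro tendsto_add tendsto_const lim_1_over_n [THEN LIMSEQ_Suc])
    then have b_lim: "((\<lambda>n. b + 1 / real (Suc n)) \<circ> k) \<longlonglongrightarrow> b"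
      using k by (simp add: LIMSEQ_subseq_LIMSEQ)
    have "Q y \<le> b"
      by (rule Q_limit_le [OF lim _ b_lim]) (use Y(2) less_imp_le in auto)
    then show ?thesis using y by (auto simp: Z_def)
  qed
  have branches: "y / q \<in> {-A..A}" "(y + t) / q \<in> {-A..A}" if "y \<in> {-A..A}" for y
  proof -
    have "0 \<le> A" using A by linarith
    then have "2 * A \<le> q * A" using q_ge by (intro mult_right_mono) auto
    moreover have "- A \<le> y" "y \<le> A" "0 < real_of_int t" using that t by auto
    ultimately have "- A * q \<le> y" "y \<le> A * q" "- A * q \<le> y + t" "y + t \<le> A * q"
      using A \<open>0 \<le> A\<close> unfolding mult.commute [of q A] mult_minus_left by linarith+
    then show "y / q \<in> {-A..A}" "(y + t) / q \<in> {-A..A}"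
      using q_ge by (simp_all add: pos_divide_le_eq pos_le_divide_eq)
  qed
  \<comment> \<open>A mean of values that are at least \<open>b\<close> can be at most
    \<open>b\<close> only if every value of positive weight equals \<open>b\<close>.\<close>
  have low: "y / q \<in> Z" if y: "y \<in> Z" and c: "cos (pi * y / 2) \<noteq> 0" for y
  proof -
    have yA: "y \<in> {-A..A}" "Q y \<le> b" using y by (auto simp: Z_def)
    have "(sin (pi * y / 2))\<^sup>2 * b \<le> (sin (pi * y / 2))\<^sup>2 * Q ((y + t) / q)"
      using b_le branches [OF yA(1)] by (intro mult_left_mono) auto
    moreover have "b = (cos (pi * y / 2))\<^sup>2 * b + (sin (pi * y / 2))\<^sup>2 * b"
      unfolding distrib_right [symmetric] by simp
    ultimately have "(cos (pi * y / 2))\<^sup>2 * Q (y / q) \<le> (cos (pi * y / 2))\<^sup>2 * b"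
      using Q_refinement [of y] yA(2) by linarith
    then have "Q (y / q) \<le> b" using c by simp
    then show ?thesis using branches [OF yA(1)] by (simp add: Z_def)
  qed
  have high: "(y + t) / q \<in> Z" if y: "y \<in> Z" and c: "sin (pi * y / 2) \<noteq> 0" for y
  proof -
    have yA: "y \<in> {-A..A}" "Q y \<le> b" using y by (auto simp: Z_def)
    have "(cos (pi * y / 2))\<^sup>2 * b \<le> (cos (pi * y / 2))\<^sup>2 * Q (y / q)"
      using b_le branches [OF yA(1)] by (intro mult_left_mono) auto
    moreover have "b = (cos (pi * y / 2))\<^sup>2 * b + (sin (pi * y / 2))\<^sup>2 * b"
      unfolding distrib_right [symmetric] by simp
    ultimately have "(sin (pi * y / 2))\<^sup>2 * Q ((y + t) / q) \<le> (sin (pi * y / 2))\<^sup>2 * b"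
      using Q_refinement [of y] yA(2) by linarith
    then have "Q ((y + t) / q) \<le> b" using c by simp
    then show ?thesis using branches [OF yA(1)] by (simp add: Z_def)
  qed
  have ints: "y \<in> \<int>" if y: "y \<in> Z" for y
  proof (rule ccontr)
    assume "y \<notin> \<int>"
    have not_int: "y / q ^ k \<notin> \<int>" for k
    proof
      assume "y / q ^ k \<in> \<int>"
      then have "y / q ^ k * q ^ k \<in> \<int>" by (intro Ints_mult Ints_power) auto
      then show False using \<open>y \<notin> \<int>\<close> by simp
    qed
    have "y / q ^ k \<in> Z" for k
    proof (induction k)
      case (Suc k)
      \<comment> \<open>The cosine vanishes only at odd integers, and no \<open>y / q ^ k\<close> is
        an integer.\<close>
      have "cos (pi * (y / q ^ k) / 2) \<noteq> 0"
      proof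
        assume "cos (pi * (y / q ^ k) / 2) = 0"
        then obtain i where i: "odd i" "pi * (y / q ^ k) / 2 = of_int i * (pi / 2)"
          unfolding cos_zero_iff_int by blast
        then have "y / q ^ k = of_int i" by (simp add: field_simps)
        then show False using not_int [of k] by auto
      qed
      then have "y / q ^ k / q \<in> Z" by (rule low [OF Suc])
      then show ?case by (simp add: mult.commute)
    qed (use y in simp)
    moreover have "(\<lambda>k. y * (1 / q) ^ k) \<longlonglongrightarrow> y * 0"
      using q_ge by (intro tendsto_mult tendsto_const LIMSEQ_power_zero) auto
    then have "(\<lambda>k. y / q ^ k) \<longlonglongrightarrow> 0" by (simp add: power_one_over field_simps)
    ultimately have "0 \<in> Z" using closed [of "\<lambda>k. y / q ^ k" 0] by blast
    then show False using \<open>0 \<notin> Z\<close> by simp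
  qed
  define D where "D = {i :: int. of_int i \<in> Z}"
  have "integer_trap r t D"
    unfolding integer_trap_def
  proof (intro conjI ballI)
    have "D \<subseteq> {\<lfloor>-A\<rfloor>..\<lceil>A\<rceil>}" by (auto simp: D_def Z_def) linarith+
    then show "finite D" by (rule finite_subset) simp
    show "D \<noteq> {}" using \<open>Z \<noteq> {}\<close> ints by (fastforce simp: D_def elim: Ints_cases)
    show "0 \<notin> D" using \<open>0 \<notin> Z\<close> by (simp add: D_def)
    fix z assume "z \<in> D"
    then have z: "of_int z \<in> Z" by (simp add: D_def)
    have succ: "\<exists>z'\<in>D. 2 ^ r * z' = w" if w: "of_int w / q \<in> Z" for w
    proof -
      obtain z' where z': "of_int w / q = of_int z'" using ints [OF w] by (elim Ints_cases)
      then have "real_of_int w = real_of_int (2 ^ r * z')" using q_ge by (simp add: field_simps)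
      then have "2 ^ r * z' = w" by (simp only: of_int_eq_iff)
      then show ?thesis using z' w by (intro bexI [of _ z']) (auto simp: D_def)
    qed
    show "\<exists>z'\<in>D. 2 ^ r * z' = z \<or> 2 ^ r * z' = z + t"
    proof (cases "cos (pi * of_int z / 2) = 0")
      case True
      then have "sin (pi * of_int z / 2) \<noteq> 0" using sin_cos_squared_add [of "pi * of_int z / 2"] by auto
      then have "of_int (z + t) / q \<in> Z" using high [OF z] by simp
      then show ?thesis using succ by blast
    next
      case False
      then show ?thesis using succ low [OF z] by blast
    qed
  qed
  then show False using no_trap by blast
qed

text \<open>By \<open>Q_ge_1\<close> some finite Bessel sum exceeds \<open>1 - \<epsilon>\<close>,
  and \<open>bessel_expo\<close> converts this into a projection error below
  \<open>\<epsilon>\<close>.\<close>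

lemma closed_span_expo: "closed_span ((*) (real_of_int t) ` Lambda r) (expo x)"
  unfolding closed_span_def
proof (intro conjI allI impI)
  show "square_integrable M (expo x)" by (rule square_integrable_bounded [of _ 1]) auto
  fix \<epsilon> :: real assume "\<epsilon> > 0"
  have "\<not> Q (- x) \<le> 1 - \<epsilon>" using Q_ge_1 [of "- x"] \<open>\<epsilon> > 0\<close> by simp
  then obtain F where F: "finite F" "F \<subseteq> Lambda r" "1 - \<epsilon> < (\<Sum>l\<in>F. (cmod (ft (- x + t * l)))\<^sup>2)"
    using Q_le [of "- x" "1 - \<epsilon>"] by fastforce
  then have "(\<integral>y. (cmod (expo x y - (\<Sum>l\<in>(*) (real_of_int t) ` F. ft (x - l) * expo l y)))\<^sup>2 \<partial>M) < \<epsilon>"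
    using bessel_expo [OF F(1,2), of "- x"] by simp
  then show "\<exists>F c. finite F \<and> F \<subseteq> (*) (real_of_int t) ` Lambda r \<and>
      (\<integral>y. (cmod (expo x y - (\<Sum>l\<in>F. c l * expo l y)))\<^sup>2 \<partial>M) < \<epsilon>"
    using F(1,2) by (intro exI [of _ "(*) (real_of_int t) ` F"] exI [of _ "\<lambda>l. ft (x - l)"]) auto
qed

theorem spectral_pair: "spectral_pair M ((*) (real_of_int t) ` Lambda r)"
  unfolding spectral_pair_def
  using prob_space_axioms compactly_supported countable_Lambda orthonormal_odd_times_Lambda [OF t(1)]
    total_exponentialsI [OF AE_support closed_span_expo]
  by simp

end

theorem theorem1p8:
  fixes r p n :: nat
  assumes "r \<ge> 2"
    and "prime p" and "odd p" and "p \<noteq> 2 ^ r - 1"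
    and "even (r * ord p 2) \<or> \<not> r dvd (p - 1)"
    and "n \<ge> 1"
  shows "complete_number (cantor_measure r) (Lambda r) (real p ^ n)"
proof -
  interpret cantor_distribution r "cantor_measure r"
    using assms(1) by unfold_locales (auto intro: invariant_cantor_measure)
  \<comment> \<open>\<open>complete_number\<close> also demands that the undilated pair be spectral;
    the dilation factor 1 provides this.\<close>
  interpret one: cantor_odd_dilation r "cantor_measure r" 1
    using no_integer_trap_1 [OF assms(1)] by unfold_locales auto
  interpret pn: cantor_odd_dilation r "cantor_measure r" "int p ^ n"
    using no_integer_trap_prime_power [OF assms(1-5)] assms(2,3)
    by unfold_locales (auto simp: prime_gt_0_nat)
  show ?thesis
    unfolding complete_number_def using one.spectral_pair pn.spectral_pair by simp
qed

end
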